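(* Let $Y$ be a Banach space and let $\omega:(0,\infty)\to(0,\infty)$ be a non-decreasing function such that $\lim_{t\to 0}\omega(t)=0$, $\lim_{t\to\infty}\omega(t)=\infty$, $\lim_{t\to 0}t/\omega(t)=0$, for some constant $C_{\mathrm{db}}>1$, $\omega(2t)\le C_{\mathrm{db}}\,\omega(t)$ for all $t\in(0,\infty)$, and $$\sup_{s>0}\frac1{\omega(s)}\int_0^s\omega(t)\,\frac{dt}{t}<\infty .$$ Then $$\mathrm{VMO}^\omega(\mathbb R^n,Y)=\overline{C^\infty_c(\mathbb R^n,Y)}^{\,\mathrm{BMO}^\omega(\mathbb R^n,Y)}.$$
   Context: Here $n\ge1$. Cubes $Q\subset\mathbb R^n$ have sides parallel to the axes and side length $\ell(Q)$; $\langle f\rangle_Q=\frac1{|Q|}\int_Qf$ (Bochner integral, Lebesgue measure). For locally Bochner integrable $f\in L^1_{\mathrm{loc}}(\mathbb R^n,Y)$ put $\mathcal O^\omega(f;Q)=\frac1{\omega(\ell(Q))}\frac1{|Q|}\int_Q\|f-\langle f\rangle_Q\|_Y$ and $\|f\|_{\mathrm{BMO}^\omega(\mathbb R^n,Y)}=\sup_Q\mathcal O^\omega(f;Q)$ (supremum over all cubes); $\mathrm{BMO}^\omega(\mathbb R^n,Y)$ is the set of $f\in L^1_{\mathrm{loc}}(\mathbb R^n,Y)$ (functions identified when equal a.e.) with $\|f\|_{\mathrm{BMO}^\omega}<\infty$. Define $\mathrm{VMO}^\omega_{\mathrm{small}}=\{f\in\mathrm{BMO}^\omega:\lim_{\delta\to0}\sup_{\ell(Q)=\delta}\mathcal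 O^\omega(f;Q)=0\}$, $\mathrm{VMO}^\omega_{\mathrm{large}}=\{f\in\mathrm{BMO}^\omega:\lim_{\delta\to\infty}\sup_{\ell(Q)=\delta}\mathcal O^\omega(f;Q)=0\}$, $\mathrm{VMO}^\omega_{\mathrm{far}}=\{f\in\mathrm{BMO}^\omega:\lim_{\delta\to\infty}\sup_{\mathrm{dist}(Q,0)>\delta}\mathcal O^\omega(f;Q)=0\}$, all for functions $\mathbb R^n\to Y$, and $\mathrm{VMO}^\omega(\mathbb R^n,Y)$ as the intersection of the three. $C^\infty_c(\mathbb R^n,Y)$ is the set of compactly supported $C^\infty$ maps $\mathbb R^n\to Y$. The closure $\overline{\mathcal C}^{\,\mathrm{BMO}^\omega}$ is the set of $f\in\mathrm{BMO}^\omega(\mathbb R^n,Y)$ for which there is a sequence $(f_n)\subset\mathcal C$ with $\|f_n-f\|_{\mathrm{BMO}^\omega}\to0$. *)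

theory Defs
  imports "HOL-Analysis.Analysis"
begin

section \<open>The Bochner integral in an arbitrary Banach space\<close>

text \<open>
  The Bochner integral of HOL-Analysis is restricted to second countable (that is, separable)
  target spaces. The following definitions have the same shape as the library's, with Borel
  measurability of the integrand replaced by strong measurability, so that they also cover
  non-separable target spaces.
\<close>

definition strongly_measurable :: "'a measure \<Rightarrow> ('a \<Rightarrow> 'b::banach) \<Rightarrow> bool" where
  "strongly_measurable M f \<longleftrightarrow>
     (\<exists>s. (\<forall>i. simple_function M (s i)) \<and> (AE x in M. (\<lambda>i::nat. s i x) \<longlonglongrightarrow> f x))"

definition has_strong_bochner_integral :: "'a measure \<Rightarrow> ('a \<Rightarrow> 'b::banach) \<Rightarrow> 'b \<Rightarrow> bool" where
  "has_strong_bochner_integral M f I \<longleftrightarrow>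
     strongly_measurable M f \<and>
     (\<exists>s. (\<forall>i. Bochner_Integration.simple_bochner_integrable M (s i)) \<and>
          (\<lambda>i::nat. \<integral>\<^sup>+x. ennreal (norm (f x - s i x)) \<partial>M) \<longlonglongrightarrow> 0 \<and>
          (\<lambda>i. Bochner_Integration.simple_bochner_integral M (s i)) \<longlonglongrightarrow> I)"

definition strong_bochner_integrable :: "'a measure \<Rightarrow> ('a \<Rightarrow> 'b::banach) \<Rightarrow> bool" where
  "strong_bochner_integrable M f \<longleftrightarrow> (\<exists>I. has_strong_bochner_integral M f I)"

definition strong_bochner_integral :: "'a measure \<Rightarrow> ('a \<Rightarrow> 'b::banach) \<Rightarrow> 'b" where
  "strong_bochner_integral M f =
     (if strong_bochner_integrable M f then THE I. has_strong_bochner_integral M f I else 0)"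

lemma has_strong_bochner_integral_if_has_bochner_integral:
  fixes f :: "'a \<Rightarrow> 'b::{banach, second_countable_topology}"
  assumes "has_bochner_integral M f I"
  shows "has_strong_bochner_integral M f I"
  using assms
proof cases
  case (1 s)
  from borel_measurable_implies_sequence_metric[OF 1(1), of 0]
  have "strongly_measurable M f"
    unfolding strongly_measurable_def by (auto intro: AE_I2)
  with 1 show ?thesis
    unfolding has_strong_bochner_integral_def by blast
qed

lemma strongly_measurable_norm_diff:
  assumes "strongly_measurable M f" "simple_function M t"
  shows "\<exists>g\<in>borel_measurable M. AE x in M. ennreal (norm (f x - t x)) = g x"
proof -
  from assms obtain s where s: "\<And>i. simple_function M (s i)"
    and lim: "AE x in M. (\<lambda>i::nat. s i x) \<longlonglongrightarrow> f x"
    unfolding strongly_measurable_def by blast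
  define h where "h = (\<lambda>i x. ennreal (norm (s i x - t x)))"
  have [measurable]: "h i \<in> borel_measurable M" for i
    unfolding h_def
    by (intro borel_measurable_simple_function simple_function_compose1[of _ _ ennreal]
        simple_function_compose1[of _ _ norm] simple_function_compose2[of _ _ _ "(-)"] s assms(2))
  have "AE x in M. ennreal (norm (f x - t x)) = liminf (\<lambda>i. h i x)"
    using lim
  proof eventually_elim
    case (elim x)
    have "(\<lambda>i. h i x) \<longlonglongrightarrow> ennreal (norm (f x - t x))"
      unfolding h_def by (intro tendsto_intros elim)
    then show ?case
      by (simp add: lim_imp_Liminf)
  qed
  moreover have "(\<lambda>x. liminf (\<lambda>i. h i x)) \<in> borel_measurable M"
    by measurable
  ultimately show ?thesis by (rule bexI)
qed

lemma simple_bochner_integral_dist_le: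
  fixes f :: "'a \<Rightarrow> 'b::banach"
  assumes f: "strongly_measurable M f"
    and s: "Bochner_Integration.simple_bochner_integrable M s" and t: "Bochner_Integration.simple_bochner_integrable M t"
  shows "ennreal (norm (Bochner_Integration.simple_bochner_integral M s - Bochner_Integration.simple_bochner_integral M t))
    \<le> (\<integral>\<^sup>+x. ennreal (norm (f x - s x)) \<partial>M) + (\<integral>\<^sup>+x. ennreal (norm (f x - t x)) \<partial>M)"
proof -
  have sf: "simple_function M s" "simple_function M t"
    using s t by (auto elim: simple_bochner_integrable.cases)
  obtain g where g[measurable]: "g \<in> borel_measurable M"
    and ge: "AE x in M. ennreal (norm (f x - s x)) = g x"
    using strongly_measurable_norm_diff[OF f sf(1)] by blast
  obtain h where h[measurable]: "h \<in> borel_measurable M"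
    and he: "AE x in M. ennreal (norm (f x - t x)) = h x"
    using strongly_measurable_norm_diff[OF f sf(2)] by blast
  have st: "Bochner_Integration.simple_bochner_integrable M (\<lambda>x. s x - t x)"
    using s t by (rule simple_bochner_integrable_compose2[of "(-)", rotated]) simp
  have "ennreal (norm (Bochner_Integration.simple_bochner_integral M s - Bochner_Integration.simple_bochner_integral M t))
      = ennreal (norm (Bochner_Integration.simple_bochner_integral M (\<lambda>x. s x - t x)))"
    by (simp add: simple_bochner_integral_diff[OF s t])
  also have "\<dots> \<le> ennreal (Bochner_Integration.simple_bochner_integral M (\<lambda>x. norm (s x - t x)))"
    by (intro ennreal_leI simple_bochner_integral_norm_bound st)
  also have "\<dots> = (\<integral>\<^sup>+x. ennreal (norm (s x - t x)) \<partial>M)"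
    using simple_bochner_integrable_compose2[of "\<lambda>x y. norm (x - y)", OF _ s t]
    by (intro simple_bochner_integral_eq_nn_integral) auto
  also have "\<dots> \<le> (\<integral>\<^sup>+x. g x + h x \<partial>M)"
    using ge he
  proof (intro nn_integral_mono_AE, eventually_elim)
    case (elim x)
    have "norm (s x - t x) \<le> norm (f x - s x) + norm (f x - t x)"
      using norm_triangle_ineq4[of "f x - t x" "f x - s x"] by (simp add: add.commute)
    then have "ennreal (norm (s x - t x)) \<le> ennreal (norm (f x - s x)) + ennreal (norm (f x - t x))"
      unfolding ennreal_plus[OF norm_ge_zero norm_ge_zero, symmetric] by (rule ennreal_leI)
    then show ?case
      unfolding elim .
  qed
  also have "\<dots> = (\<integral>\<^sup>+x. g x \<partial>M) + (\<integral>\<^sup>+x. h x \<partial>M)"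
    by (intro nn_integral_add) auto
  also have "(\<integral>\<^sup>+x. g x \<partial>M) = (\<integral>\<^sup>+x. ennreal (norm (f x - s x)) \<partial>M)"
    using ge by (intro nn_integral_cong_AE) auto
  also have "(\<integral>\<^sup>+x. h x \<partial>M) = (\<integral>\<^sup>+x. ennreal (norm (f x - t x)) \<partial>M)"
    using he by (intro nn_integral_cong_AE) auto
  finally show ?thesis .
qed

lemma has_strong_bochner_integral_unique:
  assumes "has_strong_bochner_integral M f I" "has_strong_bochner_integral M f J"
  shows "I = J"
proof -
  from assms obtain s t where f: "strongly_measurable M f"
    and s: "\<And>i. Bochner_Integration.simple_bochner_integrable M (s i)" "\<And>i. Bochner_Integration.simple_bochner_integrable M (t i)"
    and l: "(\<lambda>i::nat. \<integral>\<^sup>+x. ennreal (norm (f x - s i x)) \<partial>M) \<longlonglongrightarrow> 0"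
      "(\<lambda>i::nat. \<integral>\<^sup>+x. ennreal (norm (f x - t i x)) \<partial>M) \<longlonglongrightarrow> 0"
    and I: "(\<lambda>i. Bochner_Integration.simple_bochner_integral M (s i)) \<longlonglongrightarrow> I"
    and J: "(\<lambda>i. Bochner_Integration.simple_bochner_integral M (t i)) \<longlonglongrightarrow> J"
    unfolding has_strong_bochner_integral_def by blast
  let ?d = "\<lambda>i. norm (Bochner_Integration.simple_bochner_integral M (s i) - Bochner_Integration.simple_bochner_integral M (t i))"
  have "(\<lambda>i. ennreal (?d i)) \<longlonglongrightarrow> ennreal (norm (I - J))"
    by (intro tendsto_intros I J)
  moreover have "(\<lambda>i. ennreal (?d i)) \<longlonglongrightarrow> 0"
  proof (rule tendsto_sandwich[OF _ _ tendsto_const])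
    show "(\<lambda>i. (\<integral>\<^sup>+x. ennreal (norm (f x - s i x)) \<partial>M) +
        (\<integral>\<^sup>+x. ennreal (norm (f x - t i x)) \<partial>M)) \<longlonglongrightarrow> 0"
      using tendsto_add[OF l] by simp
  qed (rule always_eventually, rule allI, rule simple_bochner_integral_dist_le[OF f s] zero_le)+
  ultimately have "ennreal (norm (I - J)) = 0"
    by (rule LIMSEQ_unique)
  then show ?thesis by simp
qed

lemma strong_bochner_integral_eqI:
  assumes "has_strong_bochner_integral M f I"
  shows "strong_bochner_integral M f = I"
proof -
  have "(THE I. has_strong_bochner_integral M f I) = I"
    by (rule the_equality) (rule assms, erule has_strong_bochner_integral_unique[OF _ assms])
  moreover have "strong_bochner_integrable M f"
    unfolding strong_bochner_integrable_def using assms by (rule exI)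
  ultimately show ?thesis
    unfolding strong_bochner_integral_def by simp
qed

definition locally_bochner_integrable :: "('a::euclidean_space \<Rightarrow> 'b::banach) \<Rightarrow> bool" where
  "locally_bochner_integrable f \<longleftrightarrow>
     (\<forall>K. compact K \<longrightarrow> strong_bochner_integrable (lebesgue_on K) f)"

section \<open>Cubes and mean oscillation\<close>

definition cube :: "real ^ 'n \<Rightarrow> real \<Rightarrow> (real ^ 'n) set" where
  "cube a l = cbox a (\<chi> i. a $ i + l)"

definition average :: "(real ^ 'n) set \<Rightarrow> (real ^ 'n \<Rightarrow> 'b::banach) \<Rightarrow> 'b" where
  "average Q f = strong_bochner_integral (lebesgue_on Q) f /\<^sub>R measure lebesgue Q"

text \<open>
  The oscillation takes values in the extended nonnegative reals, so that the suprema below are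
  always meaningful. It is used for locally integrable functions and \<open>l > 0\<close> only.
\<close>

definition osc :: "(real \<Rightarrow> real) \<Rightarrow> (real ^ 'n \<Rightarrow> 'b::banach) \<Rightarrow> real ^ 'n \<Rightarrow> real \<Rightarrow> ennreal" where
  "osc \<omega> f a l =
     1 / ennreal (\<omega> l) * (1 / emeasure lebesgue (cube a l) *
       (\<integral>\<^sup>+x. ennreal (norm (f x - average (cube a l) f)) \<partial>lebesgue_on (cube a l)))"

definition bmo_norm :: "(real \<Rightarrow> real) \<Rightarrow> (real ^ 'n \<Rightarrow> 'b::banach) \<Rightarrow> ennreal" where
  "bmo_norm \<omega> f = (SUP (a, l)\<in>{(a, l). 0 < l}. osc \<omega> f a l)"

text \<open>
  The function spaces are represented by the sets of all representatives, without passing to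
  equivalence classes modulo null sets.
\<close>

definition BMO :: "(real \<Rightarrow> real) \<Rightarrow> (real ^ 'n \<Rightarrow> 'b::banach) set" where
  "BMO \<omega> = {f. locally_bochner_integrable f \<and> bmo_norm \<omega> f < \<infinity>}"

definition VMO_small :: "(real \<Rightarrow> real) \<Rightarrow> (real ^ 'n \<Rightarrow> 'b::banach) set" where
  "VMO_small \<omega> = {f \<in> BMO \<omega>. ((\<lambda>\<delta>. SUP a. osc \<omega> f a \<delta>) \<longlongrightarrow> 0) (at_right 0)}"

definition VMO_large :: "(real \<Rightarrow> real) \<Rightarrow> (real ^ 'n \<Rightarrow> 'b::banach) set" where
  "VMO_large \<omega> = {f \<in> BMO \<omega>. ((\<lambda>\<delta>. SUP a. osc \<omega> f a \<delta>) \<longlongrightarrow> 0) at_top}"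

definition VMO_far :: "(real \<Rightarrow> real) \<Rightarrow> (real ^ 'n \<Rightarrow> 'b::banach) set" where
  "VMO_far \<omega> = {f \<in> BMO \<omega>.
     ((\<lambda>\<delta>. SUP (a, l)\<in>{(a, l). 0 < l \<and> setdist (cube a l) {0} > \<delta>}. osc \<omega> f a l) \<longlongrightarrow> 0) at_top}"

definition VMO :: "(real \<Rightarrow> real) \<Rightarrow> (real ^ 'n \<Rightarrow> 'b::banach) set" where
  "VMO \<omega> = VMO_small \<omega> \<inter> VMO_large \<omega> \<inter> VMO_far \<omega>"

definition BMO_closure ::
    "(real \<Rightarrow> real) \<Rightarrow> (real ^ 'n \<Rightarrow> 'b::banach) set \<Rightarrow> (real ^ 'n \<Rightarrow> 'b) set" where
  "BMO_closure \<omega> C = {f \<in> BMO \<omega>.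
     \<exists>g :: nat \<Rightarrow> real ^ 'n \<Rightarrow> 'b.
       (\<forall>k. g k \<in> C) \<and> (\<lambda>k. bmo_norm \<omega> (\<lambda>x. g k x - f x)) \<longlonglongrightarrow> 0}"

section \<open>Compactly supported smooth maps\<close>

text \<open>
  Iterated Frechet derivatives are expressed through directional derivatives, since the type of
  the Frechet derivative of order \<open>k\<close> changes with \<open>k\<close>.
\<close>

primrec C_k :: "nat \<Rightarrow> ('a::euclidean_space \<Rightarrow> 'b::real_normed_vector) \<Rightarrow> bool" where
  "C_k 0 f \<longleftrightarrow> continuous_on UNIV f"
| "C_k (Suc k) f \<longleftrightarrow>
     (\<forall>x. f differentiable (at x)) \<and> (\<forall>v. C_k k (\<lambda>x. frechet_derivative f (at x) v))"

definition Cc_infinity :: "('a::euclidean_space \<Rightarrow> 'b::real_normed_vector) set" where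
  "Cc_infinity = {f. (\<forall>k. C_k k f) \<and> compact (closure {x. f x \<noteq> 0})}"

end

theory Submission
  imports Defs
begin

text \<open>
  By the Dini condition the averages of \<open>f \<in> BMO \<omega>\<close> over cubes shrinking to \<open>x\<close> telescope to a limit
  \<open>rep x\<close> with \<open>norm (rep x - rep y) \<le> K * E * \<omega> (norm (x - y))\<close>, where \<open>E\<close> bounds the oscillation over
  cubes near \<open>x\<close> and \<open>y\<close>; bisecting cubes shows \<open>f = rep\<close> almost everywhere. Conversely such a
  modulus of continuity bounds the oscillation by doubling, so the approximation may be carried out
  in the pointwise seminorm. Vanishing oscillation on large and on distant cubes gives, for every
  \<open>e > 0\<close>, the bound \<open>norm (u x - u y) \<le> e * \<omega> (norm (x - y))\<close> for \<open>u = rep - rep 0\<close> as soon as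
  \<open>norm x \<ge> r\<close>. Running from \<open>0\<close> to \<open>y\<close> in steps of length \<open>d\<close> then yields
  \<open>norm (u y) \<le> 4 * e * (R * \<omega> d / d)\<close> for \<open>norm y \<le> 2 * R\<close>, \<open>d \<le> R\<close> and \<open>R\<close> large, which is exactly what is needed to
  multiply \<open>u\<close> by a Lipschitz cut-off at scale \<open>R\<close>. The truncated function is uniformly continuous with
  modulus \<open>o(\<omega>)\<close> by vanishing oscillation on small cubes, and is finally mollified.
\<close>

section \<open>Strong Bochner integrals\<close>

text \<open>The seminorm ignores null sets and constants, so the work can be done on
  \<open>rep - rep 0\<close>, which has a definite value at every point and vanishes at 0. The
  obstacle is the cut-off. The product rule leaves a term of size
  \<open>norm (x - y) / R * norm (u y)\<close>, which must be at most a numerical multiple of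
  \<open>e * \<omega> (norm (x - y))\<close>. The global modulus bounds \<open>norm (u y)\<close>
  only by a fixed multiple of \<open>\<omega> (2 * R)\<close>: the factor is not small and the scale
  is wrong. Taking the step length equal to the distance \<open>d = norm (x - y)\<close> cures both:
  about \<open>R / d\<close> steps, each costing \<open>e * \<omega> d\<close>, cancel against the
  factor \<open>d / R\<close>. Mollification then costs only a numerical factor. Averages of
  translates keep a translation invariant modulus at small distances, and beyond the mollification
  radius \<open>d\<close> the uniform error \<open>e * \<omega> d\<close> is already dominated by
  monotonicity. In the converse inclusion each kind of vanishing has its own source: Lipschitz
  continuity and \<open>t / \<omega> t\<close> tending to 0 for small cubes, boundedness and
  \<open>\<omega>\<close> tending to infinity for large ones, compact support for distant
  ones.\<close>

lemma simple_function_strongly_measurable: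
  "simple_function M s \<Longrightarrow> strongly_measurable M s"
  unfolding strongly_measurable_def by (auto intro!: exI[of _ "\<lambda>_. s"])

lemma strongly_measurable_diff:
  assumes "strongly_measurable M f" "strongly_measurable M g"
  shows "strongly_measurable M (\<lambda>x. f x - g x)"
proof -
  obtain s where s: "\<And>i::nat. simple_function M (s i)" "AE x in M. (\<lambda>i. s i x) \<longlonglongrightarrow> f x"
    using assms(1) unfolding strongly_measurable_def by blast
  obtain t where t: "\<And>i::nat. simple_function M (t i)" "AE x in M. (\<lambda>i. t i x) \<longlonglongrightarrow> g x"
    using assms(2) unfolding strongly_measurable_def by blast
  have "simple_function M (\<lambda>x. s i x - t i x)" for i
    by (intro simple_function_compose2[of _ _ _ "(-)"] s t)
  moreover have "AE x in M. (\<lambda>i. s i x - t i x) \<longlonglongrightarrow> f x - g x"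
    using s(2) t(2) by eventually_elim (intro tendsto_intros)
  ultimately show ?thesis unfolding strongly_measurable_def by (intro exI[of _ "\<lambda>i x. s i x - t i x"]) auto
qed

text \<open>Strong measurability is an almost everywhere limit and \<open>M\<close> need not be
  complete, so the norm is measurable only after a change on a null set. Additivity of the integral
  is always applied to such a version \<open>h\<close>.\<close>

lemma strongly_measurable_AE_norm:
  assumes "strongly_measurable M f"
  obtains h where "h \<in> borel_measurable M" "AE x in M. ennreal (norm (f x)) = h x"
  using strongly_measurable_norm_diff[OF assms, of "\<lambda>_. 0"] by auto

lemma nn_integral_norm_diff_le:
  assumes "strongly_measurable M f" "strongly_measurable M g"
  shows "(\<integral>\<^sup>+x. ennreal (norm (f x - g x)) \<partial>M) \<le>
    (\<integral>\<^sup>+x. ennreal (norm (f x)) \<partial>M) + (\<integral>\<^sup>+x. ennreal (norm (g x)) \<partial>M)"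
proof -
  obtain u where u[measurable]: "u \<in> borel_measurable M" and ue: "AE x in M. ennreal (norm (f x)) = u x"
    using strongly_measurable_AE_norm[OF assms(1)] .
  obtain v where v[measurable]: "v \<in> borel_measurable M" and ve: "AE x in M. ennreal (norm (g x)) = v x"
    using strongly_measurable_AE_norm[OF assms(2)] .
  have "(\<integral>\<^sup>+x. ennreal (norm (f x - g x)) \<partial>M) \<le> (\<integral>\<^sup>+x. u x + v x \<partial>M)"
    using ue ve
  proof (intro nn_integral_mono_AE, eventually_elim)
    case (elim x)
    have "ennreal (norm (f x - g x)) \<le> ennreal (norm (f x)) + ennreal (norm (g x))"
      by (metis ennreal_leI ennreal_plus norm_ge_zero norm_triangle_ineq4)
    then show ?case unfolding elim .
  qed
  also have "\<dots> = (\<integral>\<^sup>+x. u x \<partial>M) + (\<integral>\<^sup>+x. v x \<partial>M)"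
    by (intro nn_integral_add) auto
  also have "(\<integral>\<^sup>+x. u x \<partial>M) = (\<integral>\<^sup>+x. ennreal (norm (f x)) \<partial>M)"
    using ue by (intro nn_integral_cong_AE) auto
  also have "(\<integral>\<^sup>+x. v x \<partial>M) = (\<integral>\<^sup>+x. ennreal (norm (g x)) \<partial>M)"
    using ve by (intro nn_integral_cong_AE) auto
  finally show ?thesis .
qed

lemma has_strong_bochner_integral_diff:
  assumes "has_strong_bochner_integral M f I" "has_strong_bochner_integral M g J"
  shows "has_strong_bochner_integral M (\<lambda>x. f x - g x) (I - J)"
proof -
  note simp_int = Bochner_Integration.simple_bochner_integrable.cases
  from assms obtain s t where sm: "strongly_measurable M f" "strongly_measurable M g"
    and s: "\<And>i. Bochner_Integration.simple_bochner_integrable M (s i)"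
    and t: "\<And>i. Bochner_Integration.simple_bochner_integrable M (t i)"
    and l: "(\<lambda>i::nat. \<integral>\<^sup>+x. ennreal (norm (f x - s i x)) \<partial>M) \<longlonglongrightarrow> 0"
      "(\<lambda>i::nat. \<integral>\<^sup>+x. ennreal (norm (g x - t i x)) \<partial>M) \<longlonglongrightarrow> 0"
    and I: "(\<lambda>i. Bochner_Integration.simple_bochner_integral M (s i)) \<longlonglongrightarrow> I"
    and J: "(\<lambda>i. Bochner_Integration.simple_bochner_integral M (t i)) \<longlonglongrightarrow> J"
    unfolding has_strong_bochner_integral_def by blast
  have sf: "simple_function M (s i)" "simple_function M (t i)" for i
    using s[of i] t[of i] by (auto elim: simp_int)
  have "(\<lambda>i::nat. \<integral>\<^sup>+x. ennreal (norm (f x - g x - (s i x - t i x))) \<partial>M) \<longlonglongrightarrow> 0"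
  proof (rule tendsto_sandwich[OF _ _ tendsto_const])
    show "\<forall>\<^sub>F i in sequentially. (\<integral>\<^sup>+x. ennreal (norm (f x - g x - (s i x - t i x))) \<partial>M)
       \<le> (\<integral>\<^sup>+x. ennreal (norm (f x - s i x)) \<partial>M) + (\<integral>\<^sup>+x. ennreal (norm (g x - t i x)) \<partial>M)"
    proof (intro always_eventually allI)
      fix i
      have "strongly_measurable M (\<lambda>x. f x - s i x)" "strongly_measurable M (\<lambda>x. g x - t i x)"
        by (intro strongly_measurable_diff sm simple_function_strongly_measurable sf)+
      from nn_integral_norm_diff_le[OF this]
      show "(\<integral>\<^sup>+x. ennreal (norm (f x - g x - (s i x - t i x))) \<partial>M)
       \<le> (\<integral>\<^sup>+x. ennreal (norm (f x - s i x)) \<partial>M) + (\<integral>\<^sup>+x. ennreal (norm (g x - t i x)) \<partial>M)"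
        by (simp add: algebra_simps)
    qed
    show "(\<lambda>i. (\<integral>\<^sup>+x. ennreal (norm (f x - s i x)) \<partial>M) +
        (\<integral>\<^sup>+x. ennreal (norm (g x - t i x)) \<partial>M)) \<longlonglongrightarrow> 0"
      using tendsto_add[OF l] by simp
  qed simp
  moreover have "(\<lambda>i. Bochner_Integration.simple_bochner_integral M (\<lambda>x. s i x - t i x)) \<longlonglongrightarrow> I - J"
    using tendsto_diff[OF I J] by (simp add: simple_bochner_integral_diff[OF s t])
  moreover have "Bochner_Integration.simple_bochner_integrable M (\<lambda>x. s i x - t i x)" for i
    using s[of i] t[of i] by (rule simple_bochner_integrable_compose2[of "(-)", rotated]) simp
  ultimately show ?thesis
    unfolding has_strong_bochner_integral_def
    using strongly_measurable_diff[OF sm] by (intro conjI exI[of _ "\<lambda>i x. s i x - t i x"]) auto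
qed

lemma has_strong_bochner_integral_norm_le:
  assumes "has_strong_bochner_integral M f I"
  shows "ennreal (norm I) \<le> (\<integral>\<^sup>+x. ennreal (norm (f x)) \<partial>M)"
proof -
  from assms obtain s where sm: "strongly_measurable M f"
    and s: "\<And>i. Bochner_Integration.simple_bochner_integrable M (s i)"
    and l: "(\<lambda>i::nat. \<integral>\<^sup>+x. ennreal (norm (f x - s i x)) \<partial>M) \<longlonglongrightarrow> 0"
    and I: "(\<lambda>i. Bochner_Integration.simple_bochner_integral M (s i)) \<longlonglongrightarrow> I"
    unfolding has_strong_bochner_integral_def by blast
  \<comment> \<open>With the zero function as second approximant,
    \<open>simple_bochner_integral_dist_le\<close> bounds the simple integrals themselves.\<close>
  have z: "Bochner_Integration.simple_bochner_integrable M (\<lambda>_. 0 :: 'b)"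
    by (auto intro!: Bochner_Integration.simple_bochner_integrable.intros)
  have z0: "Bochner_Integration.simple_bochner_integral M (\<lambda>_. 0 :: 'b) = 0"
    unfolding simple_bochner_integral_def by (intro sum.neutral) auto
  have "(\<lambda>i. (\<integral>\<^sup>+x. ennreal (norm (f x - s i x)) \<partial>M) + (\<integral>\<^sup>+x. ennreal (norm (f x)) \<partial>M))
      \<longlonglongrightarrow> 0 + (\<integral>\<^sup>+x. ennreal (norm (f x)) \<partial>M)"
    by (intro tendsto_add l tendsto_const)
  moreover have "(\<lambda>i. ennreal (norm (Bochner_Integration.simple_bochner_integral M (s i)))) \<longlonglongrightarrow> ennreal (norm I)"
    by (intro tendsto_intros I)
  moreover have "ennreal (norm (Bochner_Integration.simple_bochner_integral M (s i))) \<le>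
      (\<integral>\<^sup>+x. ennreal (norm (f x - s i x)) \<partial>M) + (\<integral>\<^sup>+x. ennreal (norm (f x)) \<partial>M)" for i
    using simple_bochner_integral_dist_le[OF sm s z] by (simp add: z0)
  ultimately show ?thesis
    by (auto intro: LIMSEQ_le)
qed

lemma has_strong_bochner_integral_const:
  assumes "emeasure M (space M) < \<infinity>"
  shows "has_strong_bochner_integral M (\<lambda>_. c) (measure M (space M) *\<^sub>R c)"
proof -
  have 1: "Bochner_Integration.simple_bochner_integrable M (\<lambda>_. c)"
    using assms by (cases "c = 0") (auto intro!: Bochner_Integration.simple_bochner_integrable.intros)
  have 2: "Bochner_Integration.simple_bochner_integral M (\<lambda>_. c) = measure M (space M) *\<^sub>R c"
  proof (cases "space M = {}")
    case False
    then have "(\<lambda>_. c) ` space M = {c}" "{x \<in> space M. c = c} = space M" by auto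
    then show ?thesis unfolding simple_bochner_integral_def by simp
  qed (simp add: simple_bochner_integral_def)
  show ?thesis
    unfolding has_strong_bochner_integral_def
    using 1 2 by (auto intro!: exI[of _ "\<lambda>_ _. c"] simple_function_strongly_measurable)
qed

text \<open>On a space of finite measure \<open>V\<close> a uniform error \<open>1 / (i + 1)\<close>
  is an integrated error of at most \<open>V / (i + 1)\<close>, so the simple integrals form a
  Cauchy sequence.\<close>

lemma strong_bochner_integrable_uniform_limit:
  assumes fin: "emeasure M (space M) < \<infinity>"
    and s: "\<And>i::nat. simple_function M (s i)"
    and bd: "\<And>i x. x \<in> space M \<Longrightarrow> norm (f x - s i x) \<le> inverse (real (Suc i))"
  shows "strong_bochner_integrable M f"
proof -
  have si: "Bochner_Integration.simple_bochner_integrable M (s i)" for i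
  proof (intro Bochner_Integration.simple_bochner_integrable.intros s)
    have "emeasure M {y \<in> space M. s i y \<noteq> 0} \<le> emeasure M (space M)"
      by (intro emeasure_mono) auto
    then show "emeasure M {y \<in> space M. s i y \<noteq> 0} \<noteq> \<infinity>" using fin by (auto simp: top_unique)
  qed
  have sl: "(\<lambda>i. s i x) \<longlonglongrightarrow> f x" if "x \<in> space M" for x
  proof -
    have "(\<lambda>i. norm (s i x - f x)) \<longlonglongrightarrow> 0"
      using bd[OF that] by (intro tendsto_sandwich[OF _ _ tendsto_const LIMSEQ_inverse_real_of_nat])
        (auto simp: norm_minus_commute)
    then show ?thesis by (simp add: LIM_zero_iff tendsto_norm_zero_iff)
  qed
  have sm: "strongly_measurable M f"
    unfolding strongly_measurable_def using s sl by (intro exI[of _ s]) auto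
  define V where "V = measure M (space M)"
  have V: "emeasure M (space M) = ennreal V" "V \<ge> 0"
    using fin unfolding V_def by (auto simp: emeasure_eq_ennreal_measure less_top)
  have ib: "(\<integral>\<^sup>+x. ennreal (norm (f x - s i x)) \<partial>M) \<le> ennreal (V * inverse (real (Suc i)))" for i
  proof -
    have "(\<integral>\<^sup>+x. ennreal (norm (f x - s i x)) \<partial>M) \<le> (\<integral>\<^sup>+x. ennreal (inverse (real (Suc i))) \<partial>M)"
      by (intro nn_integral_mono ennreal_leI bd)
    also have "\<dots> = ennreal (V * inverse (real (Suc i)))"
      using V by (simp add: ennreal_mult mult.commute)
    finally show ?thesis .
  qed
  have V0: "(\<lambda>i. V * inverse (real (Suc i))) \<longlonglongrightarrow> 0"
    using tendsto_mult_right_zero[OF LIMSEQ_inverse_real_of_nat] by simp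
  have il: "(\<lambda>i. \<integral>\<^sup>+x. ennreal (norm (f x - s i x)) \<partial>M) \<longlonglongrightarrow> 0"
    by (rule tendsto_sandwich[OF _ _ tendsto_const tendsto_ennrealI[OF V0, simplified]])
      (use ib in auto)
  have "Cauchy (\<lambda>i. Bochner_Integration.simple_bochner_integral M (s i))"
  proof (rule metric_CauchyI)
    fix e :: real assume e: "e > 0"
    have "\<forall>\<^sub>F i in sequentially. V * inverse (real (Suc i)) < e / 2"
      using order_tendstoD(2)[OF V0, of "e / 2"] e by simp
    then obtain N where N: "\<And>i. i \<ge> N \<Longrightarrow> V * inverse (real (Suc i)) < e / 2"
      unfolding eventually_sequentially by blast
    show "\<exists>N. \<forall>m\<ge>N. \<forall>n\<ge>N. dist (Bochner_Integration.simple_bochner_integral M (s m))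
        (Bochner_Integration.simple_bochner_integral M (s n)) < e"
    proof (intro exI[of _ N] allI impI)
      fix m n assume mn: "m \<ge> N" "n \<ge> N"
      have "ennreal (norm (Bochner_Integration.simple_bochner_integral M (s m) - Bochner_Integration.simple_bochner_integral M (s n)))
        \<le> ennreal (V * inverse (real (Suc m))) + ennreal (V * inverse (real (Suc n)))"
        using simple_bochner_integral_dist_le[OF sm si si, of m n] add_mono[OF ib[of m] ib[of n]]
        by (rule order_trans)
      also have "\<dots> = ennreal (V * inverse (real (Suc m)) + V * inverse (real (Suc n)))"
        using V by (intro ennreal_plus[symmetric]) auto
      finally have "norm (Bochner_Integration.simple_bochner_integral M (s m) - Bochner_Integration.simple_bochner_integral M (s n))
        \<le> V * inverse (real (Suc m)) + V * inverse (real (Suc n))"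
        using V by (subst (asm) ennreal_le_iff) (auto intro!: add_nonneg_nonneg mult_nonneg_nonneg)
      with N[OF mn(1)] N[OF mn(2)]
      show "dist (Bochner_Integration.simple_bochner_integral M (s m))
        (Bochner_Integration.simple_bochner_integral M (s n)) < e" by (simp add: dist_norm)
    qed
  qed
  then obtain I where "(\<lambda>i. Bochner_Integration.simple_bochner_integral M (s i)) \<longlonglongrightarrow> I"
    using Cauchy_convergent convergent_def by blast
  then show ?thesis
    unfolding strong_bochner_integrable_def has_strong_bochner_integral_def using sm si il by blast
qed

lemma emeasure_lebesgue_on_compact:
  "compact K \<Longrightarrow> emeasure (lebesgue_on K) (space (lebesgue_on K)) < \<infinity>"
  using lmeasurable_compact[of K]
  using emeasure_restrict_space[of K lebesgue K] fmeasurableD[of K lebesgue] fmeasurableD2[of K lebesgue]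
  by (auto simp del: emeasure_completion simp: space_restrict_space less_top)

text \<open>The target may be non-separable, but the image of \<open>K\<close> is compact and hence
  totally bounded: finitely many values approximate \<open>f\<close> uniformly.\<close>

lemma strong_bochner_integrable_continuous:
  fixes f :: "'a::euclidean_space \<Rightarrow> 'b::banach"
  assumes K: "compact K" and f: "continuous_on K f"
  shows "strong_bochner_integrable (lebesgue_on K) f"
proof -
  have KL: "K \<in> sets lebesgue" using K by (simp add: lmeasurable_compact fmeasurableD)
  have "\<exists>s. simple_function (lebesgue_on K) s \<and> (\<forall>x\<in>K. norm (f x - s x) \<le> e)" if e: "e > 0" for e
  proof -
    have "compact (f ` K)" using K f by (rule compact_continuous_image[rotated])
    then obtain T where T: "finite T" "f ` K \<subseteq> (\<Union>p\<in>T. ball p e)"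
      using e unfolding compact_eq_totally_bounded by blast
    \<comment> \<open>The induction over the centres asks for the approximation only where
      \<open>f\<close> already lies in one of the balls treated so far. A new centre
      \<open>p\<close> overrides the old value on the preimage of its ball, which is relatively open
      and so measurable.\<close>
    have "\<exists>s. simple_function (lebesgue_on K) s \<and> (\<forall>x\<in>K. f x \<in> (\<Union>p\<in>T. ball p e) \<longrightarrow> norm (f x - s x) \<le> e)"
      using T(1)
    proof induction
      case empty
      show ?case by (auto intro!: exI[of _ "\<lambda>_. 0"])
    next
      case (insert p T)
      then obtain s where s: "simple_function (lebesgue_on K) s"
        "\<And>x. x \<in> K \<Longrightarrow> f x \<in> (\<Union>p\<in>T. ball p e) \<Longrightarrow> norm (f x - s x) \<le> e" by blast
      define S where "S = {x \<in> K. f x \<in> ball p e}"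
      have "openin (top_of_set K) S"
        unfolding S_def using continuous_openin_preimage_gen[OF f, of "ball p e"]
        by (simp add: vimage_def Int_def)
      then obtain U where "open U" "S = K \<inter> U" by (auto simp: openin_open)
      then have "S \<in> sets (lebesgue_on K)"
        using KL by (auto simp: sets_restrict_space)
      then have "simple_function (lebesgue_on K) (\<lambda>x. if x \<in> S then p else s x)"
        using s(1) by (intro simple_function_If_set) (auto simp: S_def space_restrict_space Int_absorb2)
      moreover have "norm (f x - (if x \<in> S then p else s x)) \<le> e"
        if "x \<in> K" "f x \<in> (\<Union>p\<in>insert p T. ball p e)" for x
        using that s(2)[of x] by (auto simp: S_def dist_norm norm_minus_commute)
      ultimately show ?case by blast
    qed
    with T(2) show ?thesis by blast
  qed
  then have "\<exists>s. simple_function (lebesgue_on K) s \<and> (\<forall>x\<in>K. norm (f x - s x) \<le> inverse (real (Suc i)))" for i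
    by simp
  then obtain s where "\<And>i. simple_function (lebesgue_on K) (s i)"
    "\<And>i x. x \<in> K \<Longrightarrow> norm (f x - s i x) \<le> inverse (real (Suc i))" by metis
  then show ?thesis
    by (intro strong_bochner_integrable_uniform_limit[of _ s] emeasure_lebesgue_on_compact K) auto
qed

lemma locally_bochner_integrable_continuous:
  "continuous_on UNIV f \<Longrightarrow> locally_bochner_integrable f"
  unfolding locally_bochner_integrable_def
  by (meson continuous_on_subset strong_bochner_integrable_continuous top_greatest)

lemma locally_bochner_integrable_diff:
  assumes "locally_bochner_integrable f" "locally_bochner_integrable g"
  shows "locally_bochner_integrable (\<lambda>x. f x - g x)"
  unfolding locally_bochner_integrable_def
proof (intro allI impI)
  fix K :: "'a set" assume "compact K"
  with assms obtain I J where "has_strong_bochner_integral (lebesgue_on K) f I"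
    "has_strong_bochner_integral (lebesgue_on K) g J"
    unfolding locally_bochner_integrable_def strong_bochner_integrable_def by blast
  from has_strong_bochner_integral_diff[OF this]
  show "strong_bochner_integrable (lebesgue_on K) (\<lambda>x. f x - g x)"
    unfolding strong_bochner_integrable_def by blast
qed

section \<open>Cubes and mean oscillation\<close>

lemma mem_cube: "x \<in> cube a l \<longleftrightarrow> (\<forall>i. a $ i \<le> x $ i \<and> x $ i \<le> a $ i + l)"
  by (auto simp: cube_def mem_box_cart)

lemma compact_cube [simp]: "compact (cube a l)"
  by (simp add: cube_def)

lemma cube_lebesgue [simp, measurable]: "cube a l \<in> sets lebesgue"
  by (simp add: cube_def)

lemma corner_in_cube [simp]: "0 \<le> l \<Longrightarrow> a \<in> cube a l"
  by (simp add: mem_cube)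

lemma measure_cube:
  fixes a :: "real ^ 'n"
  assumes "l \<ge> 0"
  shows "measure lebesgue (cube a l) = l ^ CARD('n)"
proof -
  have "cbox a (\<chi> i. a $ i + l) \<noteq> {}"
    using assms by (auto simp: interval_ne_empty_cart)
  then show ?thesis by (simp add: cube_def content_cbox_cart)
qed

lemma emeasure_cube:
  fixes a :: "real ^ 'n"
  assumes "l \<ge> 0"
  shows "emeasure lebesgue (cube a l) = ennreal (l ^ CARD('n))"
proof -
  have "cube a l \<in> lmeasurable" by (simp add: lmeasurable_compact)
  then show ?thesis using measure_cube[OF assms, of a]
    by (simp add: emeasure_eq_measure2 del: emeasure_completion)
qed

lemma cube_subset:
  assumes "\<And>i. a $ i \<le> b $ i" "\<And>i. b $ i + r \<le> a $ i + l"
  shows "cube b r \<subseteq> cube a l"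
proof
  fix x assume "x \<in> cube b r"
  then show "x \<in> cube a l"
    unfolding mem_cube by (metis assms order_trans)
qed

lemma cube_subset_side:
  fixes a b :: "real ^ 'n"
  assumes "cube b r \<subseteq> cube a l" "r \<ge> 0"
  shows "r \<le> l"
proof -
  have "b \<in> cube b r" "(\<chi> i. b $ i + r) \<in> cube b r"
    using assms(2) by (auto simp: mem_cube)
  then have "b \<in> cube a l" "(\<chi> i. b $ i + r) \<in> cube a l"
    using assms(1) by blast+
  then have "a $ undefined \<le> b $ undefined" "b $ undefined + r \<le> a $ undefined + l"
    unfolding mem_cube by auto
  then show ?thesis by simp
qed

lemma norm_diff_cube:
  fixes x z :: "real ^ 'n"
  assumes "x \<in> cube a l" "z \<in> cube a l"
  shows "norm (x - z) \<le> real CARD('n) * l"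
proof -
  have "norm (x - z) \<le> (\<Sum>i\<in>UNIV. \<bar>(x - z) $ i\<bar>)" by (rule norm_le_l1_cart)
  also have "\<dots> \<le> (\<Sum>i\<in>(UNIV :: 'n set). l)"
  proof (rule sum_mono)
    fix i
    have "a $ i \<le> x $ i" "x $ i \<le> a $ i + l" "a $ i \<le> z $ i" "z $ i \<le> a $ i + l"
      using assms unfolding mem_cube by auto
    then show "\<bar>(x - z) $ i\<bar> \<le> l" by (simp add: abs_le_iff)
  qed
  finally show ?thesis by simp
qed

text \<open>The Euclidean norm dominates every coordinate difference, so a cube with side exactly
  \<open>norm (x - y)\<close> holds both points and \<open>\<omega>\<close> is evaluated at the
  distance itself.\<close>

lemma component_min_cube:
  fixes x y :: "real ^ 'n"
  shows "x \<in> cube (\<chi> i. min (x $ i) (y $ i)) (norm (x - y))" "y \<in> cube (\<chi> i. min (x $ i) (y $ i)) (norm (x - y))"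
proof -
  have min: "p \<le> min p q + d \<and> q \<le> min p q + d" if "\<bar>p - q\<bar> \<le> d" for p q d :: real
    using that by (simp add: min_def abs_le_iff)
  have "\<bar>x $ i - y $ i\<bar> \<le> norm (x - y)" for i
    using component_le_norm_cart[of "x - y" i] by simp
  then have "x $ i \<le> min (x $ i) (y $ i) + norm (x - y) \<and> y $ i \<le> min (x $ i) (y $ i) + norm (x - y)" for i
    by (rule min)
  then show "x \<in> cube (\<chi> i. min (x $ i) (y $ i)) (norm (x - y))" "y \<in> cube (\<chi> i. min (x $ i) (y $ i)) (norm (x - y))"
    unfolding mem_cube by simp_all
qed

text \<open>The set \<open>S\<close> records the coordinates in which the upper half is taken. The
  closed pieces share faces, so later estimates use them as a cover and not as a partition.\<close>

lemma cube_halves: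
  fixes a :: "real ^ 'n"
  assumes "l \<ge> 0"
  shows "cube a l = (\<Union>S\<in>UNIV. cube (a + (\<chi> i. if i \<in> S then l / 2 else 0)) (l / 2))"
proof (rule set_eqI)
  fix x
  show "x \<in> cube a l \<longleftrightarrow> x \<in> (\<Union>S\<in>UNIV. cube (a + (\<chi> i. if i \<in> S then l / 2 else 0)) (l / 2))"
  proof
    assume "x \<in> cube a l"
    then have "x \<in> cube (a + (\<chi> i. if i \<in> {i. x $ i \<ge> a $ i + l / 2} then l / 2 else 0)) (l / 2)"
      unfolding mem_cube by (auto simp: add.assoc)
    then show "x \<in> (\<Union>S\<in>UNIV. cube (a + (\<chi> i. if i \<in> S then l / 2 else 0)) (l / 2))" by blast
  next
    assume "x \<in> (\<Union>S\<in>UNIV. cube (a + (\<chi> i. if i \<in> S then l / 2 else 0)) (l / 2))"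
    then obtain S where S: "x \<in> cube (a + (\<chi> i. if i \<in> S then l / 2 else 0)) (l / 2)" by blast
    moreover have "cube (a + (\<chi> i. if i \<in> S then l / 2 else 0)) (l / 2) \<subseteq> cube a l"
      using assms by (intro cube_subset) auto
    ultimately show "x \<in> cube a l" by blast
  qed
qed

lemma nn_integral_lebesgue_on_mono:
  assumes "A \<in> sets lebesgue" "B \<in> sets lebesgue" "A \<subseteq> B"
  shows "(\<integral>\<^sup>+x. h x \<partial>lebesgue_on A) \<le> (\<integral>\<^sup>+x. h x \<partial>lebesgue_on B)"
  using assms
  by (subst (1 2) nn_integral_restrict_space) (auto intro!: nn_integral_mono split: split_indicator)

lemma locally_bochner_integrable_cube:
  assumes "locally_bochner_integrable f"
  shows "has_strong_bochner_integral (lebesgue_on (cube a l)) f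
    (strong_bochner_integral (lebesgue_on (cube a l)) f)"
proof -
  have "strong_bochner_integrable (lebesgue_on (cube a l)) f"
    using assms unfolding locally_bochner_integrable_def by simp
  then show ?thesis
    unfolding strong_bochner_integrable_def by (metis strong_bochner_integral_eqI)
qed

lemma locally_strongly_measurable:
  "locally_bochner_integrable f \<Longrightarrow> strongly_measurable (lebesgue_on (cube a l)) f"
  using locally_bochner_integrable_cube has_strong_bochner_integral_def by blast

lemma locally_bochner_integrable_const: "locally_bochner_integrable (\<lambda>_. c)"
  by (intro locally_bochner_integrable_continuous continuous_on_const)

lemma average_diff:
  assumes "locally_bochner_integrable f" "locally_bochner_integrable g"
  shows "average (cube a l) (\<lambda>x. f x - g x) = average (cube a l) f - average (cube a l) g"
  unfolding average_def
  by (subst strong_bochner_integral_eqI[OF has_strong_bochner_integral_diff[OF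
        locally_bochner_integrable_cube[OF assms(1)] locally_bochner_integrable_cube[OF assms(2)]]])
    (simp add: scaleR_diff_right)

lemma average_const:
  assumes "l > 0"
  shows "average (cube a l) (\<lambda>_. c) = c"
proof -
  have "has_strong_bochner_integral (lebesgue_on (cube a l)) (\<lambda>_. c)
      (measure (lebesgue_on (cube a l)) (space (lebesgue_on (cube a l))) *\<^sub>R c)"
    by (intro has_strong_bochner_integral_const emeasure_lebesgue_on_compact compact_cube)
  from strong_bochner_integral_eqI[OF this] show ?thesis
    using assms by (simp add: average_def measure_restrict_space space_restrict_space measure_cube)
qed

lemma norm_average_le:
  fixes a :: "real ^ 'n"
  assumes f: "locally_bochner_integrable f" and l: "l > 0"
  shows "ennreal (norm (average (cube a l) f) * l ^ CARD('n)) \<le>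
    (\<integral>\<^sup>+x. ennreal (norm (f x)) \<partial>lebesgue_on (cube a l))"
proof -
  have "norm (average (cube a l) f) * l ^ CARD('n) = norm (strong_bochner_integral (lebesgue_on (cube a l)) f)"
    using l by (simp add: average_def measure_cube)
  then show ?thesis
    using has_strong_bochner_integral_norm_le[OF locally_bochner_integrable_cube[OF f]] by simp
qed

lemma norm_average_diff_le:
  fixes a :: "real ^ 'n"
  assumes f: "locally_bochner_integrable f" and l: "l > 0"
  shows "ennreal (norm (average (cube a l) f - c) * l ^ CARD('n)) \<le>
    (\<integral>\<^sup>+x. ennreal (norm (f x - c)) \<partial>lebesgue_on (cube a l))"
  using norm_average_le[OF locally_bochner_integrable_diff[OF f locally_bochner_integrable_const] l]
  by (simp add: average_diff[OF f locally_bochner_integrable_const] average_const[OF l])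

text \<open>Clears the extended real denominators once and for all. If the integral is infinite,
  both sides fail.\<close>

lemma osc_le_iff:
  fixes a :: "real ^ 'n"
  assumes l: "l > 0" and w: "\<omega> l > 0" and E: "E \<ge> 0"
  shows "osc \<omega> f a l \<le> ennreal E \<longleftrightarrow>
    (\<integral>\<^sup>+x. ennreal (norm (f x - average (cube a l) f)) \<partial>lebesgue_on (cube a l))
      \<le> ennreal (E * \<omega> l * l ^ CARD('n))" (is "_ \<longleftrightarrow> ?X \<le> _")
proof -
  define V where "V = l ^ CARD('n)"
  have V: "V > 0" using l by (simp add: V_def)
  have o: "osc \<omega> f a l = ennreal (1 / \<omega> l) * (ennreal (1 / V) * ?X)"
    using l w V unfolding osc_def V_def emeasure_cube[OF less_imp_le[OF l]]
    by (simp add: divide_ennreal flip: ennreal_1)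
  show ?thesis
  proof (cases ?X)
    case (real r)
    have "osc \<omega> f a l = ennreal (r / (\<omega> l * V))"
      unfolding o real using w V real by (simp add: ennreal_mult' [symmetric])
    then show ?thesis
      unfolding real(2) V_def[symmetric] using w V E real(1)
      by (simp add: ennreal_le_iff pos_divide_le_eq mult_ac)
  next
    case top
    then show ?thesis unfolding o using w V by (simp add: ennreal_mult_top top_unique)
  qed
qed

text \<open>With \<open>c\<close> the average over the large cube, the integral of
  \<open>norm (f x - c)\<close> only grows when the small cube is replaced by the large one;
  dividing by the smaller volume costs the volume ratio.\<close>

lemma average_subcube_dist:
  fixes a b :: "real ^ 'n"
  assumes f: "locally_bochner_integrable f" and w: "\<omega> l > 0" and r: "r > 0" and l: "l > 0"
    and sub: "cube b r \<subseteq> cube a l" and E: "E \<ge> 0" "osc \<omega> f a l \<le> ennreal E"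
  shows "norm (average (cube b r) f - average (cube a l) f) \<le> (l / r) ^ CARD('n) * E * \<omega> l"
proof -
  let ?c = "average (cube a l) f"
  have "ennreal (norm (average (cube b r) f - ?c) * r ^ CARD('n)) \<le>
      (\<integral>\<^sup>+x. ennreal (norm (f x - ?c)) \<partial>lebesgue_on (cube b r))"
    by (rule norm_average_diff_le[OF f r])
  also have "\<dots> \<le> (\<integral>\<^sup>+x. ennreal (norm (f x - ?c)) \<partial>lebesgue_on (cube a l))"
    by (rule nn_integral_lebesgue_on_mono) (use sub in auto)
  also have "\<dots> \<le> ennreal (E * \<omega> l * l ^ CARD('n))"
    using E(2) osc_le_iff[of l \<omega> E f a] l w E by auto
  finally have "norm (average (cube b r) f - ?c) * r ^ CARD('n) \<le> E * \<omega> l * l ^ CARD('n)"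
    using E w l by (subst (asm) ennreal_le_iff) auto
  then show ?thesis using r by (simp add: power_divide field_simps)
qed

text \<open>The average itself lies within \<open>A\<close> of \<open>c\<close>, hence the factor 2
  for replacing \<open>c\<close> by the average.\<close>

lemma osc_le_of_AE_bound:
  fixes a :: "real ^ 'n"
  assumes f: "locally_bochner_integrable f" and w: "\<omega> l > 0" and l: "l > 0" and A: "A \<ge> 0"
    and bd: "AE x in lebesgue_on (cube a l). norm (f x - c) \<le> A"
  shows "osc \<omega> f a l \<le> ennreal (2 * A / \<omega> l)"
proof -
  let ?L = "lebesgue_on (cube a l)"
  have sp: "emeasure ?L (space ?L) = ennreal (l ^ CARD('n))"
    using emeasure_cube[of l a] l by (simp add: emeasure_restrict_space space_restrict_space del: emeasure_completion)
  have 1: "(\<integral>\<^sup>+x. ennreal (norm (f x - c)) \<partial>?L) \<le> ennreal (A * l ^ CARD('n))"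
  proof -
    have "(\<integral>\<^sup>+x. ennreal (norm (f x - c)) \<partial>?L) \<le> (\<integral>\<^sup>+x. ennreal A \<partial>?L)"
      using bd by (intro nn_integral_mono_AE) (auto intro: ennreal_leI)
    also have "\<dots> = ennreal (A * l ^ CARD('n))" using sp A l by (simp add: ennreal_mult)
    finally show ?thesis .
  qed
  have "ennreal (norm (average (cube a l) f - c) * l ^ CARD('n)) \<le> ennreal (A * l ^ CARD('n))"
    using norm_average_diff_le[OF f l] 1 by (rule order_trans)
  then have c: "norm (average (cube a l) f - c) \<le> A"
    using A l by (subst (asm) ennreal_le_iff) auto
  have "AE x in ?L. norm (f x - average (cube a l) f) \<le> 2 * A"
    using bd
  proof eventually_elim
    case (elim x)
    then show ?case
      using norm_triangle_ineq4[of "f x - c" "average (cube a l) f - c"] c by simp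
  qed
  then have "(\<integral>\<^sup>+x. ennreal (norm (f x - average (cube a l) f)) \<partial>?L) \<le> (\<integral>\<^sup>+x. ennreal (2 * A) \<partial>?L)"
    by (intro nn_integral_mono_AE) (auto intro: ennreal_leI)
  also have "\<dots> = ennreal (2 * A * l ^ CARD('n))" using sp A l by (simp add: ennreal_mult)
  also have "\<dots> = ennreal (2 * A / \<omega> l * \<omega> l * l ^ CARD('n))" using w by simp
  finally show ?thesis
    using osc_le_iff[of l \<omega> "2 * A / \<omega> l" f a] l w A by simp
qed

lemma osc_diff_le:
  assumes "locally_bochner_integrable f" "locally_bochner_integrable g"
  shows "osc \<omega> (\<lambda>x. f x - g x) a l \<le> osc \<omega> f a l + osc \<omega> g a l"
proof -
  let ?f = "\<lambda>x. f x - average (cube a l) f" and ?g = "\<lambda>x. g x - average (cube a l) g"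
  have "strongly_measurable (lebesgue_on (cube a l)) ?f" "strongly_measurable (lebesgue_on (cube a l)) ?g"
    by (intro locally_strongly_measurable locally_bochner_integrable_diff assms locally_bochner_integrable_const)+
  from nn_integral_norm_diff_le[OF this]
  have *: "(\<integral>\<^sup>+x. ennreal (norm (f x - g x - (average (cube a l) f - average (cube a l) g))) \<partial>lebesgue_on (cube a l))
    \<le> (\<integral>\<^sup>+x. ennreal (norm (?f x)) \<partial>lebesgue_on (cube a l)) + (\<integral>\<^sup>+x. ennreal (norm (?g x)) \<partial>lebesgue_on (cube a l))"
    by (simp add: diff_diff_eq2 diff_add_eq add_diff_eq diff_diff_eq add.commute)
  show ?thesis
    unfolding osc_def average_diff[OF assms] distrib_left[symmetric]
    by (intro mult_left_mono *) auto
qed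

lemma osc_le_bmo_norm: "l > 0 \<Longrightarrow> osc \<omega> f a l \<le> bmo_norm \<omega> f"
  unfolding bmo_norm_def by (intro SUP_upper2[of "(a, l)"]) auto

lemma bmo_norm_leI: "(\<And>a l. l > 0 \<Longrightarrow> osc \<omega> f a l \<le> E) \<Longrightarrow> bmo_norm \<omega> f \<le> E"
  unfolding bmo_norm_def by (intro SUP_least) auto

lemma nn_integral_lebesgue_on_cover:
  assumes F: "strongly_measurable (lebesgue_on A) F" and A: "A \<in> sets lebesgue"
    and I: "finite I" and Q: "\<And>i. i \<in> I \<Longrightarrow> Q i \<in> sets lebesgue" and cov: "A = (\<Union>i\<in>I. Q i)"
  shows "(\<integral>\<^sup>+x. ennreal (norm (F x)) \<partial>lebesgue_on A) \<le>
    (\<Sum>i\<in>I. \<integral>\<^sup>+x. ennreal (norm (F x)) \<partial>lebesgue_on (Q i))"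
proof -
  let ?M = "lebesgue_on A"
  obtain h where h[measurable]: "h \<in> borel_measurable ?M" and he: "AE x in ?M. ennreal (norm (F x)) = h x"
    using strongly_measurable_AE_norm[OF F] .
  have QA: "Q i \<subseteq> A" if "i \<in> I" for i using that cov by auto
  have QM: "Q i \<in> sets ?M" if "i \<in> I" for i
    using Q[OF that] QA[OF that] A by (auto simp: sets_restrict_space)
  have "(\<integral>\<^sup>+x. ennreal (norm (F x)) \<partial>?M) = (\<integral>\<^sup>+x. h x \<partial>?M)"
    by (rule nn_integral_cong_AE[OF he])
  also have "\<dots> \<le> (\<integral>\<^sup>+x. (\<Sum>i\<in>I. h x * indicator (Q i) x) \<partial>?M)"
  proof (rule nn_integral_mono)
    fix x assume "x \<in> space ?M"
    then obtain i where i: "i \<in> I" "x \<in> Q i" using cov by (auto simp: space_restrict_space)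
    then have "h x = h x * indicator (Q i) x" by simp
    also have "\<dots> \<le> (\<Sum>i\<in>I. h x * indicator (Q i) x)"
      using i I by (intro member_le_sum) auto
    finally show "h x \<le> (\<Sum>i\<in>I. h x * indicator (Q i) x)" .
  qed
  also have "\<dots> = (\<Sum>i\<in>I. \<integral>\<^sup>+x. h x * indicator (Q i) x \<partial>?M)"
    using QM by (intro nn_integral_sum) auto
  also have "\<dots> = (\<Sum>i\<in>I. \<integral>\<^sup>+x. ennreal (norm (F x)) \<partial>lebesgue_on (Q i))"
  proof (rule sum.cong[OF refl])
    fix i assume i: "i \<in> I"
    have "(\<integral>\<^sup>+x. h x * indicator (Q i) x \<partial>?M) = (\<integral>\<^sup>+x. ennreal (norm (F x)) * indicator (Q i) x \<partial>?M)"
      using he by (intro nn_integral_cong_AE) auto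
    also have "\<dots> = (\<integral>\<^sup>+x. ennreal (norm (F x)) * indicator (Q i) x * indicator A x \<partial>lebesgue)"
      using A by (intro nn_integral_restrict_space) auto
    also have "\<dots> = (\<integral>\<^sup>+x. ennreal (norm (F x)) * indicator (Q i) x \<partial>lebesgue)"
      using QA[OF i] by (intro nn_integral_cong) (auto split: split_indicator)
    also have "\<dots> = (\<integral>\<^sup>+x. ennreal (norm (F x)) \<partial>lebesgue_on (Q i))"
      using Q[OF i] by (intro nn_integral_restrict_space[symmetric]) auto
    finally show "(\<integral>\<^sup>+x. h x * indicator (Q i) x \<partial>?M) = (\<integral>\<^sup>+x. ennreal (norm (F x)) \<partial>lebesgue_on (Q i))" .
  qed
  finally show ?thesis .
qed

section \<open>The continuous representative\<close>

text \<open>The Dini condition is used only in the dyadic form \<open>dini_sum\<close>, with one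
  constant \<open>D\<close> for all scales and all numbers of terms.\<close>

locale gauge =
  fixes \<omega> :: "real \<Rightarrow> real" and C\<^sub>d D :: real
  assumes pos: "t > 0 \<Longrightarrow> \<omega> t > 0"
    and mono: "0 < s \<Longrightarrow> s \<le> t \<Longrightarrow> \<omega> s \<le> \<omega> t"
    and lim_0: "(\<omega> \<longlongrightarrow> 0) (at_right 0)"
    and lim_infinity: "filterlim \<omega> at_top at_top"
    and lim_ratio: "((\<lambda>t. t / \<omega> t) \<longlongrightarrow> 0) (at_right 0)"
    and doubling: "t > 0 \<Longrightarrow> \<omega> (2 * t) \<le> C\<^sub>d * \<omega> t"
    and dini_sum: "s > 0 \<Longrightarrow> (\<Sum>j\<le>k. \<omega> (s / 2 ^ j)) \<le> D * \<omega> s"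
begin

lemma nonneg: "t > 0 \<Longrightarrow> \<omega> t \<ge> 0"
  using pos less_imp_le by blast

lemma C_ge_1: "C\<^sub>d \<ge> 1"
proof -
  have "1 * \<omega> 1 \<le> C\<^sub>d * \<omega> 1" using doubling[of 1] mono[of 1 2] by simp
  then show ?thesis using pos[of 1] by (simp only: mult_le_cancel_right_pos)
qed

lemma D_ge_1: "D \<ge> 1"
  using dini_sum[of 1 0] pos[of 1] by simp

lemma small_ex:
  assumes "e > 0"
  obtains d where "d > 0" "\<And>t. 0 < t \<Longrightarrow> t \<le> d \<Longrightarrow> \<omega> t < e"
proof -
  have "\<forall>\<^sub>F t in at_right 0. \<omega> t < e" using lim_0 assms by (rule order_tendstoD(2))
  then obtain b where "b > 0" "\<And>t. 0 < t \<Longrightarrow> t < b \<Longrightarrow> \<omega> t < e"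
    unfolding eventually_at_right_field by auto
  then show ?thesis by (intro that[of "b / 2"]) auto
qed

lemma large_ex:
  obtains T where "T > 0" "\<And>t. T \<le> t \<Longrightarrow> A \<le> \<omega> t"
proof -
  have "\<forall>\<^sub>F t in at_top. A \<le> \<omega> t" using lim_infinity by (simp add: filterlim_at_top)
  then obtain N where "\<And>t. t \<ge> N \<Longrightarrow> A \<le> \<omega> t" unfolding eventually_at_top_linorder by auto
  then show ?thesis by (intro that[of "max N 1"]) auto
qed

lemma tendsto_halving:
  assumes l: "l > 0"
  shows "(\<lambda>m. \<omega> (l / 2 ^ m)) \<longlonglongrightarrow> 0"
proof (rule filterlim_compose[OF lim_0])
  have "(\<lambda>m. l * (1/2) ^ m) \<longlonglongrightarrow> 0"
    by (intro tendsto_mult_right_zero LIMSEQ_power_zero) simp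
  then have "(\<lambda>m. l / 2 ^ m) \<longlonglongrightarrow> 0" by (simp add: power_divide)
  then show "filterlim (\<lambda>m. l / 2 ^ m) (at_right 0) sequentially"
    unfolding filterlim_at using l by simp
qed

end

locale bmo_function = gauge +
  fixes f :: "real ^ 'n \<Rightarrow> 'y::banach" and B :: real
  assumes loc: "locally_bochner_integrable f"
    and B_nonneg: "B \<ge> 0"
    and osc_bound: "l > 0 \<Longrightarrow> osc \<omega> f a l \<le> ennreal B"
begin

text \<open>The volume ratio of cubes whose sides differ by a factor 2, which is the price of
  comparing their averages.\<close>

definition "P = (2::real) ^ CARD('n)"

lemma P_pos: "P > 0" by (simp add: P_def)

lemma average_dist_double:
  assumes E: "E \<ge> 0" "osc \<omega> f a s \<le> ennreal E" and t: "0 < t" "s \<le> 2 * t" "0 < s"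
    and sub: "cube b t \<subseteq> cube a s"
  shows "norm (average (cube b t) f - average (cube a s) f) \<le> P * E * \<omega> s"
proof -
  have "norm (average (cube b t) f - average (cube a s) f) \<le> (s / t) ^ CARD('n) * E * \<omega> s"
    using t by (intro average_subcube_dist loc pos E sub) auto
  also have "\<dots> \<le> P * E * \<omega> s"
    unfolding P_def using t E nonneg[of s]
    by (intro mult_right_mono power_mono) (auto simp: field_simps)
  finally show ?thesis .
qed

text \<open>Halving the side, with the corner fixed, until it is within a factor 2 of
  \<open>t\<close> produces a dyadic sum of \<open>\<omega>\<close>, which \<open>dini_sum\<close>
  bounds by its first term, independently of \<open>t\<close>. The oscillation bound is asked only
  for sides between \<open>t\<close> and \<open>s\<close>, so that \<open>E\<close> may be small on
  large cubes alone.\<close>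

lemma average_telescope:
  assumes t: "0 < t" "t \<le> s" and E: "E \<ge> 0" "\<And>r. t \<le> r \<Longrightarrow> r \<le> s \<Longrightarrow> osc \<omega> f x r \<le> ennreal E"
  shows "norm (average (cube x t) f - average (cube x s) f) \<le> P * D * E * \<omega> s"
proof -
  \<comment> \<open>The ratio \<open>s / t\<close> is arbitrary; the last comparison, with
    \<open>s \<le> 2 * t\<close>, absorbs what is not a power of 2.\<close>
  have ind: "norm (average (cube x t) f - average (cube x s) f) \<le> P * E * (\<Sum>j\<le>k. \<omega> (s / 2 ^ j))"
    if "t \<le> s" "s \<le> 2 ^ Suc k * t" "\<And>r. t \<le> r \<Longrightarrow> r \<le> s \<Longrightarrow> osc \<omega> f x r \<le> ennreal E" for k s
    using that
  proof (induction k arbitrary: s)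
    case 0
    have "norm (average (cube x t) f - average (cube x s) f) \<le> P * E * \<omega> s"
      using 0 t E(1) by (intro average_dist_double cube_subset 0(3)) auto
    then show ?case by simp
  next
    case (Suc k)
    have sum: "(\<Sum>j\<le>Suc k. \<omega> (s / 2 ^ j)) = \<omega> s + (\<Sum>j\<le>k. \<omega> (s / 2 / 2 ^ j))"
      by (simp add: sum.atMost_Suc_shift field_simps del: sum.atMost_Suc)
    have s: "s > 0" using Suc.prems t by simp
    show ?case
    proof (cases "s \<le> 2 * t")
      case True
      have "norm (average (cube x t) f - average (cube x s) f) \<le> P * E * \<omega> s"
        using True Suc.prems t E(1) by (intro average_dist_double cube_subset) auto
      also have "\<dots> \<le> P * E * (\<Sum>j\<le>Suc k. \<omega> (s / 2 ^ j))"
        unfolding sum using s E(1) P_pos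
        by (intro mult_left_mono) (auto intro!: sum_nonneg nonneg)
      finally show ?thesis .
    next
      case False
      have "norm (average (cube x t) f - average (cube x (s / 2)) f) \<le> P * E * (\<Sum>j\<le>k. \<omega> (s / 2 / 2 ^ j))"
        using False Suc.prems(2) s by (intro Suc.IH Suc.prems(3)) auto
      moreover have "norm (average (cube x (s / 2)) f - average (cube x s) f) \<le> P * E * \<omega> s"
        using s Suc.prems t E(1) by (intro average_dist_double cube_subset) auto
      ultimately show ?thesis
        unfolding sum distrib_left
        using norm_triangle_ineq[of "average (cube x t) f - average (cube x (s / 2)) f"
            "average (cube x (s / 2)) f - average (cube x s) f"] by simp
    qed
  qed
  obtain k where "s / t < 2 ^ k" using real_arch_pow[of 2 "s / t"] by auto
  then have "s \<le> 2 ^ Suc k * t" using t by (simp add: field_simps)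
  from ind[OF t(2) this E(2)]
  have "norm (average (cube x t) f - average (cube x s) f) \<le> P * E * (\<Sum>j\<le>k. \<omega> (s / 2 ^ j))" by simp
  also have "\<dots> \<le> P * E * (D * \<omega> s)"
    using t E(1) P_pos by (intro mult_left_mono dini_sum) auto
  finally show ?thesis by (simp add: mult_ac)
qed

text \<open>The cubes have \<open>x\<close> as a corner, not as centre. Since the telescoping bound
  holds at every \<open>x\<close>, the limit exists everywhere and not just off a null set.\<close>

definition rep :: "real ^ 'n \<Rightarrow> 'y" where
  "rep x = lim (\<lambda>k. average (cube x (inverse (real (Suc k)))) f)"

lemma rep_LIMSEQ: "(\<lambda>k. average (cube x (inverse (real (Suc k)))) f) \<longlonglongrightarrow> rep x"
proof -
  let ?u = "\<lambda>k. average (cube x (inverse (real (Suc k)))) f"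
  have "Cauchy ?u"
  proof (rule metric_CauchyI)
    fix e :: real assume e: "e > 0"
    \<comment> \<open>The summand 1 keeps the divisor positive when \<open>B = 0\<close>.\<close>
    define q where "q = P * D * B + 1"
    have q: "q > 0" using P_pos D_ge_1 B_nonneg by (simp add: q_def add_nonneg_pos)
    obtain d where d: "d > 0" "\<And>t. 0 < t \<Longrightarrow> t \<le> d \<Longrightarrow> \<omega> t < e / q"
      using small_ex[of "e / q"] e q by auto
    obtain N where N: "inverse (real (Suc N)) < d" using reals_Archimedean[OF d(1)] by auto
    have *: "dist (?u m) (?u n) < e" if "N \<le> n" "n \<le> m" for m n
    proof -
      have le: "inverse (real (Suc m)) \<le> inverse (real (Suc n))" "inverse (real (Suc n)) \<le> inverse (real (Suc N))"
        using that by (auto simp: field_simps)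
      have "dist (?u m) (?u n) \<le> P * D * B * \<omega> (inverse (real (Suc n)))"
        unfolding dist_norm using le by (intro average_telescope B_nonneg osc_bound) (auto intro: less_le_trans[rotated])
      also have "\<dots> \<le> q * \<omega> (inverse (real (Suc n)))"
        unfolding q_def by (intro mult_right_mono nonneg) auto
      also have "\<dots> < q * (e / q)"
        using q order_trans[OF le(2) less_imp_le[OF N]] by (intro mult_strict_left_mono d(2)) simp_all
      finally show ?thesis using q by simp
    qed
    show "\<exists>N. \<forall>m\<ge>N. \<forall>n\<ge>N. dist (?u m) (?u n) < e"
    proof (intro exI[of _ N] allI impI)
      fix m n assume "m \<ge> N" "n \<ge> N"
      then show "dist (?u m) (?u n) < e"
        using *[of n m] *[of m n] by (cases "n \<le> m") (auto simp: dist_commute)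
    qed
  qed
  then show ?thesis unfolding rep_def using Cauchy_convergent convergent_LIMSEQ_iff by blast
qed

text \<open>The telescoping bound does not depend on the smaller side, so it survives the
  limit.\<close>

lemma rep_average_dist:
  assumes s: "s > 0" and E: "E \<ge> 0" "\<And>r. 0 < r \<Longrightarrow> r \<le> s \<Longrightarrow> osc \<omega> f x r \<le> ennreal E"
  shows "norm (rep x - average (cube x s) f) \<le> P * D * E * \<omega> s"
proof (rule LIMSEQ_le_const2)
  show "(\<lambda>k. norm (average (cube x (inverse (real (Suc k)))) f - average (cube x s) f))
      \<longlonglongrightarrow> norm (rep x - average (cube x s) f)"
    by (intro tendsto_intros rep_LIMSEQ)
  obtain N where N: "inverse (real (Suc N)) < s" using reals_Archimedean[OF s] by auto
  show "\<exists>N. \<forall>n\<ge>N. norm (average (cube x (inverse (real (Suc n)))) f - average (cube x s) f) \<le> P * D * E * \<omega> s"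
  proof (intro exI[of _ N] allI impI)
    fix n assume "N \<le> n"
    then have "inverse (real (Suc n)) \<le> inverse (real (Suc N))" by (auto simp: field_simps)
    then have 1: "0 < inverse (real (Suc n))" "inverse (real (Suc n)) \<le> s"
      using order_trans[OF _ less_imp_le[OF N]] by simp_all
    then show "norm (average (cube x (inverse (real (Suc n)))) f - average (cube x s) f) \<le> P * D * E * \<omega> s"
      by (intro average_telescope E) (auto intro: less_le_trans[OF 1(1)])
  qed
qed

text \<open>The cube of side \<open>s\<close> with corner \<open>x\<close> may leave
  \<open>cube a s\<close>, but it stays inside the cube of twice the side. The average over the
  latter is a reference value common to all points of \<open>cube a s\<close>.\<close>

lemma rep_average_dist_larger:
  assumes s: "s > 0" and E: "E \<ge> 0" "\<And>b r. 0 < r \<Longrightarrow> cube b r \<subseteq> cube a (2 * s) \<Longrightarrow> osc \<omega> f b r \<le> ennreal E"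
    and x: "x \<in> cube a s"
  shows "norm (rep x - average (cube a (2 * s)) f) \<le> (P * D + P * C\<^sub>d) * E * \<omega> s"
proof -
  have sub: "cube x r \<subseteq> cube a (2 * s)" if "r \<le> s" for r
    using x that unfolding mem_cube by (intro cube_subset) (auto, smt (verit))
  have "norm (rep x - average (cube x s) f) \<le> P * D * E * \<omega> s"
    by (intro rep_average_dist s E sub)
  moreover have "norm (average (cube x s) f - average (cube a (2 * s)) f) \<le> P * E * \<omega> (2 * s)"
    using s by (intro average_dist_double E sub) auto
  moreover have "P * E * \<omega> (2 * s) \<le> P * E * (C\<^sub>d * \<omega> s)"
    using P_pos E(1) by (intro mult_left_mono doubling s) auto
  ultimately show ?thesis
    using norm_triangle_ineq[of "rep x - average (cube x s) f" "average (cube x s) f - average (cube a (2 * s)) f"]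
    by (simp add: algebra_simps)
qed

text \<open>The factor 2 counts the two points that are compared with one common average.\<close>

definition "K = 2 * (P * D + P * C\<^sub>d)"

lemma K_pos: "K > 0"
proof -
  have "P * D > 0" "P * C\<^sub>d > 0" using P_pos D_ge_1 C_ge_1 by (intro mult_pos_pos; simp)+
  then show ?thesis by (simp add: K_def)
qed

text \<open>Locality is the point: \<open>E\<close> has to bound the oscillation only on subcubes of
  one cube around both points. The same estimate therefore serves globally, for short distances, and
  far from the origin.\<close>

lemma rep_modulus:
  assumes E: "E \<ge> 0" "\<And>b r. 0 < r \<Longrightarrow> cube b r \<subseteq> cube (\<chi> i. min (x $ i) (y $ i)) (2 * norm (x - y)) \<Longrightarrow> osc \<omega> f b r \<le> ennreal E"
    and ne: "x \<noteq> y"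
  shows "norm (rep x - rep y) \<le> K * E * \<omega> (norm (x - y))"
proof -
  let ?a = "average (cube (\<chi> i. min (x $ i) (y $ i)) (2 * norm (x - y))) f"
  have "norm (rep z - ?a) \<le> (P * D + P * C\<^sub>d) * E * \<omega> (norm (x - y))" if "z \<in> {x, y}" for z
    using that component_min_cube ne
    by (intro rep_average_dist_larger E) fastforce+
  from this[of x] this[of y] show ?thesis
    using norm_triangle_ineq4[of "rep x - ?a" "rep y - ?a"] by (simp add: K_def algebra_simps)
qed

lemma rep_modulus_global: "x \<noteq> y \<Longrightarrow> norm (rep x - rep y) \<le> K * B * \<omega> (norm (x - y))"
  by (intro rep_modulus B_nonneg osc_bound)

lemma continuous_rep: "continuous_on UNIV rep"
proof -
  have "\<exists>d>0. \<forall>y. dist y x < d \<longrightarrow> dist (rep y) (rep x) < e" if e: "e > 0" for x e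
  proof -
    have q: "K * B + 1 > 0" using K_pos B_nonneg by (simp add: add_nonneg_pos)
    obtain d where d: "d > 0" "\<And>t. 0 < t \<Longrightarrow> t \<le> d \<Longrightarrow> \<omega> t < e / (K * B + 1)"
      using small_ex[of "e / (K * B + 1)"] e q by auto
    have "dist (rep y) (rep x) < e" if "dist y x < d" for y
    proof (cases "x = y")
      case False
      have n: "norm (y - x) > 0" "norm (y - x) \<le> d" using False that by (auto simp: dist_norm)
      have "dist (rep y) (rep x) \<le> K * B * \<omega> (norm (y - x))"
        unfolding dist_norm using False by (intro rep_modulus_global) auto
      also have "\<dots> \<le> (K * B + 1) * \<omega> (norm (y - x))"
        using nonneg[OF n(1)] by (intro mult_right_mono) auto
      also have "\<dots> < (K * B + 1) * (e / (K * B + 1))"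
        by (intro mult_strict_left_mono d(2) n q)
      finally show ?thesis using q by simp
    qed (use e in auto)
    then show ?thesis using d(1) by blast
  qed
  then show ?thesis unfolding continuous_on_iff by auto
qed

lemma locally_bochner_integrable_rep: "locally_bochner_integrable rep"
  using continuous_rep by (rule locally_bochner_integrable_continuous)

text \<open>For \<open>m = 0\<close> both \<open>f\<close> and \<open>rep\<close> are compared with
  the average. Cutting a cube into its halves preserves the total volume but moves the argument of
  \<open>\<omega>\<close> to half the side, so repeated bisection forces the integral to 0.\<close>

lemma nn_integral_rep_le:
  assumes "l > 0"
  shows "(\<integral>\<^sup>+x. ennreal (norm (f x - rep x)) \<partial>lebesgue_on (cube a l)) \<le>
    ennreal ((B + K * B + P * C\<^sub>d * B) * \<omega> (l / 2 ^ m) * l ^ CARD('n))"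
  using assms
proof (induction m arbitrary: a l)
  case (0 a l)
  let ?L = "lebesgue_on (cube a l)" and ?c = "average (cube a l) f"
  have "norm (rep x - ?c) \<le> (K * B + P * C\<^sub>d * B) * \<omega> l" if "x \<in> cube a l" for x
  proof -
    \<comment> \<open>The detour through the doubled cube is needed because the cube of side
      \<open>l\<close> with corner \<open>x\<close> need not lie in \<open>cube a l\<close>.\<close>
    let ?a = "average (cube a (2 * l)) f"
    have "norm (rep x - ?a) \<le> (P * D + P * C\<^sub>d) * B * \<omega> l"
      using 0 that by (intro rep_average_dist_larger osc_bound B_nonneg) auto
    also have "\<dots> \<le> K * B * \<omega> l"
      unfolding K_def using P_pos D_ge_1 C_ge_1 B_nonneg nonneg[OF 0]
      by (intro mult_right_mono) auto
    finally have "norm (rep x - ?a) \<le> K * B * \<omega> l" .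
    moreover have "norm (?c - ?a) \<le> P * B * \<omega> (2 * l)"
      using 0 by (intro average_dist_double osc_bound B_nonneg cube_subset) auto
    moreover have "P * B * \<omega> (2 * l) \<le> P * B * (C\<^sub>d * \<omega> l)"
      using P_pos B_nonneg 0 by (intro mult_left_mono doubling) auto
    ultimately show ?thesis
      using norm_triangle_ineq4[of "rep x - ?a" "?c - ?a"] by (simp add: algebra_simps)
  qed
  then have "(\<integral>\<^sup>+x. ennreal (norm (rep x - ?c)) \<partial>?L) \<le> (\<integral>\<^sup>+x. ennreal ((K * B + P * C\<^sub>d * B) * \<omega> l) \<partial>?L)"
    by (intro nn_integral_mono ennreal_leI) (auto simp: space_restrict_space)
  also have "\<dots> = ennreal ((K * B + P * C\<^sub>d * B) * \<omega> l * l ^ CARD('n))"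
    using emeasure_cube[of l a] 0 P_pos K_pos B_nonneg C_ge_1 nonneg[OF 0]
    by (simp add: emeasure_restrict_space space_restrict_space ennreal_mult del: emeasure_completion)
  finally have 1: "(\<integral>\<^sup>+x. ennreal (norm (rep x - ?c)) \<partial>?L) \<le> ennreal ((K * B + P * C\<^sub>d * B) * \<omega> l * l ^ CARD('n))" .
  have 2: "(\<integral>\<^sup>+x. ennreal (norm (f x - ?c)) \<partial>?L) \<le> ennreal (B * \<omega> l * l ^ CARD('n))"
    using osc_le_iff[of l \<omega> B f a] osc_bound[OF 0] 0 pos B_nonneg by auto
  have "strongly_measurable ?L (\<lambda>x. f x - ?c)" "strongly_measurable ?L (\<lambda>x. rep x - ?c)"
    by (intro locally_strongly_measurable locally_bochner_integrable_diff loc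
        locally_bochner_integrable_rep locally_bochner_integrable_const)+
  from nn_integral_norm_diff_le[OF this]
  have "(\<integral>\<^sup>+x. ennreal (norm (f x - rep x)) \<partial>?L) \<le>
      (\<integral>\<^sup>+x. ennreal (norm (f x - ?c)) \<partial>?L) + (\<integral>\<^sup>+x. ennreal (norm (rep x - ?c)) \<partial>?L)" by simp
  also have "\<dots> \<le> ennreal (B * \<omega> l * l ^ CARD('n)) + ennreal ((K * B + P * C\<^sub>d * B) * \<omega> l * l ^ CARD('n))"
    by (intro add_mono 1 2)
  also have "\<dots> = ennreal (B * \<omega> l * l ^ CARD('n) + (K * B + P * C\<^sub>d * B) * \<omega> l * l ^ CARD('n))"
    using 0 P_pos K_pos B_nonneg C_ge_1 nonneg[OF 0] by (intro ennreal_plus[symmetric]) auto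
  finally show ?case by (simp add: algebra_simps)
next
  case (Suc m a l)
  let ?q = "(B + K * B + P * C\<^sub>d * B) * \<omega> (l / 2 / 2 ^ m)"
  let ?Q = "\<lambda>S. cube (a + (\<chi> i. if i \<in> S then l / 2 else 0)) (l / 2)"
  have q: "?q \<ge> 0" using Suc.prems P_pos K_pos B_nonneg C_ge_1 by (intro mult_nonneg_nonneg nonneg) auto
  have "(\<integral>\<^sup>+x. ennreal (norm (f x - rep x)) \<partial>lebesgue_on (cube a l)) \<le>
     (\<Sum>S\<in>UNIV. \<integral>\<^sup>+x. ennreal (norm (f x - rep x)) \<partial>lebesgue_on (?Q S))"
    by (intro nn_integral_lebesgue_on_cover cube_halves locally_strongly_measurable
        locally_bochner_integrable_diff loc locally_bochner_integrable_rep)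
      (use Suc.prems in auto)
  also have "\<dots> \<le> (\<Sum>S\<in>(UNIV :: 'n set set). ennreal (?q * (l / 2) ^ CARD('n)))"
    using Suc.prems by (intro sum_mono Suc.IH) auto
  also have "\<dots> = ennreal (P * (?q * (l / 2) ^ CARD('n)))"
  proof -
    have "card (UNIV :: 'n set set) = 2 ^ CARD('n)"
      using card_Pow[of "UNIV :: 'n set"] by simp
    then have "real (card (UNIV :: 'n set set)) = P" by (simp add: P_def)
    then show ?thesis
      using q Suc.prems by (subst sum_ennreal) auto
  qed
  also have "P * (?q * (l / 2) ^ CARD('n)) = ?q * l ^ CARD('n)"
    by (simp add: P_def power_divide)
  finally show ?case by simp
qed

lemma AE_rep: "l > 0 \<Longrightarrow> AE x in lebesgue_on (cube a l). f x = rep x"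
proof -
  assume l: "l > 0"
  let ?L = "lebesgue_on (cube a l)"
  have "(\<lambda>m. ennreal ((B + K * B + P * C\<^sub>d * B) * \<omega> (l / 2 ^ m) * l ^ CARD('n)))
      \<longlonglongrightarrow> ennreal ((B + K * B + P * C\<^sub>d * B) * 0 * l ^ CARD('n))"
    by (intro tendsto_intros tendsto_halving l)
  then have "(\<integral>\<^sup>+x. ennreal (norm (f x - rep x)) \<partial>?L) \<le> 0"
    using nn_integral_rep_le[OF l] by (intro LIMSEQ_le_const) auto
  moreover obtain h where h: "h \<in> borel_measurable ?L" "AE x in ?L. ennreal (norm (f x - rep x)) = h x"
    by (rule strongly_measurable_AE_norm[OF locally_strongly_measurable[OF
            locally_bochner_integrable_diff[OF loc locally_bochner_integrable_rep]]])
  ultimately have "(\<integral>\<^sup>+x. h x \<partial>?L) = 0"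
    using nn_integral_cong_AE[OF h(2)] by simp
  then have "AE x in ?L. h x = 0"
    using h(1) by (simp add: nn_integral_0_iff_AE)
  then show "AE x in ?L. f x = rep x"
    using h(2) by eventually_elim auto
qed

end

section \<open>Vanishing oscillation and the cut-off\<close>

text \<open>The complement of a Lipschitz cut-off: \<open>1 - ramp R\<close> is 1 on the ball of
  radius \<open>R\<close> and 0 outside radius \<open>2 * R\<close>. The error of truncating
  \<open>u\<close> is thus exactly the product of \<open>ramp R\<close> and
  \<open>u\<close>.\<close>

definition ramp :: "real \<Rightarrow> 'a::real_normed_vector \<Rightarrow> real" where
  "ramp R x = max 0 (min 1 (norm x / R - 1))"

lemma ramp_bounds: "0 \<le> ramp R x" "ramp R x \<le> 1"
  by (auto simp: ramp_def)

lemma ramp_0: "R > 0 \<Longrightarrow> norm x \<le> R \<Longrightarrow> ramp R x = 0"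
  by (simp add: ramp_def field_simps)

lemma ramp_1: "R > 0 \<Longrightarrow> norm x \<ge> 2 * R \<Longrightarrow> ramp R x = 1"
  by (simp add: ramp_def field_simps)

lemma ramp_lipschitz:
  assumes "R > 0"
  shows "\<bar>ramp R x - ramp R y\<bar> \<le> norm (x - y) / R"
proof -
  have "\<bar>norm x / R - norm y / R\<bar> \<le> norm (x - y) / R"
    using assms norm_triangle_ineq3[of x y] by (simp add: diff_divide_distrib[symmetric] divide_right_mono)
  then show ?thesis unfolding ramp_def by linarith
qed

lemma continuous_ramp: "continuous_on S (ramp R)"
  unfolding ramp_def by (cases "R = 0") (auto intro!: continuous_intros)

section \<open>Moduli of continuity from vanishing oscillation\<close>

context bmo_function
begin

lemma rep_modulus_small:
  assumes S: "\<And>e. e > 0 \<Longrightarrow> \<exists>d>0. \<forall>a r. 0 < r \<longrightarrow> r \<le> d \<longrightarrow> osc \<omega> f a r \<le> ennreal e"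
    and e: "e > 0"
  shows "\<exists>d>0. \<forall>x y. x \<noteq> y \<longrightarrow> norm (x - y) \<le> d \<longrightarrow> norm (rep x - rep y) \<le> e * \<omega> (norm (x - y))"
proof -
  have "e / K > 0" using e K_pos by simp
  from S[OF this] obtain d where d: "d > 0" "\<And>a r. 0 < r \<Longrightarrow> r \<le> d \<Longrightarrow> osc \<omega> f a r \<le> ennreal (e / K)"
    by blast
  \<comment> \<open>The cube used in \<open>rep_modulus\<close> has side
    \<open>2 * norm (x - y)\<close>, hence \<open>d / 2\<close>.\<close>
  have "norm (rep x - rep y) \<le> e * \<omega> (norm (x - y))" if "x \<noteq> y" "norm (x - y) \<le> d / 2" for x y
  proof -
    have "norm (rep x - rep y) \<le> K * (e / K) * \<omega> (norm (x - y))"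
    proof (intro rep_modulus d)
      fix b r assume "0 < r" "cube b r \<subseteq> cube (\<chi> i. min (x $ i) (y $ i)) (2 * norm (x - y))"
      then have "r \<le> 2 * norm (x - y)" by (intro cube_subset_side[of b r]) auto
      then show "r \<le> d" using that by simp
    qed (use that e K_pos in auto)
    then show ?thesis using K_pos by simp
  qed
  then show ?thesis using d(1) by (intro exI[of _ "d / 2"]) auto
qed

text \<open>At sides below \<open>M\<close> only the global bound \<open>B\<close> is available.
  Telescoping from the two points up to side \<open>M\<close> costs a constant independent of the
  distance; all comparisons from \<open>M\<close> upwards use \<open>E\<close>.\<close>

lemma rep_modulus_large:
  assumes L: "\<And>a r. r \<ge> M \<Longrightarrow> osc \<omega> f a r \<le> ennreal E" and M: "M > 0" and E: "E \<ge> 0"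
    and d: "norm (x - y) \<ge> M"
  shows "norm (rep x - rep y) \<le> 2 * P * D * B * \<omega> M + K * E * \<omega> (norm (x - y))"
proof -
  let ?d = "norm (x - y)"
  let ?c = "\<chi> i. min (x $ i) (y $ i)"
  let ?a = "average (cube ?c (2 * ?d)) f"
  have d0: "?d > 0" using d M by linarith
  have *: "norm (rep z - ?a) \<le> P * D * B * \<omega> M + (P * D + P * C\<^sub>d) * E * \<omega> ?d" if "z \<in> cube ?c ?d" for z
  proof -
    have 1: "norm (rep z - average (cube z M) f) \<le> P * D * B * \<omega> M"
      by (intro rep_average_dist M B_nonneg osc_bound)
    have 2: "norm (average (cube z M) f - average (cube z ?d) f) \<le> P * D * E * \<omega> ?d"
      by (intro average_telescope M d E L)
    have "z $ i + ?d \<le> ?c $ i + 2 * ?d" "?c $ i \<le> z $ i" for i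
      using that unfolding mem_cube by (auto dest!: spec[of _ i])
    then have 3: "norm (average (cube z ?d) f - ?a) \<le> P * E * \<omega> (2 * ?d)"
      using order_trans[OF d] d0 by (intro average_dist_double E L cube_subset) (simp_all del: vec_lambda_beta)
    have 4: "P * E * \<omega> (2 * ?d) \<le> P * E * (C\<^sub>d * \<omega> ?d)"
      using P_pos E by (intro mult_left_mono doubling d0) auto
    have "norm (rep z - ?a) \<le> norm (rep z - average (cube z M) f)
        + norm (average (cube z M) f - average (cube z ?d) f) + norm (average (cube z ?d) f - ?a)"
      using norm_triangle_ineq[of "rep z - average (cube z M) f" "average (cube z M) f - average (cube z ?d) f"]
        norm_triangle_ineq[of "rep z - average (cube z ?d) f" "average (cube z ?d) f - ?a"] by simp
    also have "\<dots> \<le> P * D * B * \<omega> M + P * D * E * \<omega> ?d + P * E * (C\<^sub>d * \<omega> ?d)"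
      using 1 2 3 4 by linarith
    finally show ?thesis by (simp add: algebra_simps)
  qed
  have "norm (rep x - rep y) \<le> norm (rep x - ?a) + norm (rep y - ?a)"
    using norm_triangle_ineq4[of "rep x - ?a" "rep y - ?a"] by simp
  also have "\<dots> \<le> (P * D * B * \<omega> M + (P * D + P * C\<^sub>d) * E * \<omega> ?d) + (P * D * B * \<omega> M + (P * D + P * C\<^sub>d) * E * \<omega> ?d)"
    by (intro add_mono * component_min_cube)
  finally show ?thesis by (simp add: K_def algebra_simps)
qed

text \<open>At large distances the constant of \<open>rep_modulus_large\<close> is absorbed because
  \<open>\<omega>\<close> tends to infinity, wherever the points lie. At bounded distances every
  cube involved is near \<open>x\<close>, hence far from the origin. So a condition on
  \<open>x\<close> alone suffices.\<close>

lemma rep_modulus_far: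
  assumes L: "\<And>e. e > 0 \<Longrightarrow> \<exists>M>0. \<forall>a r. r \<ge> M \<longrightarrow> osc \<omega> f a r \<le> ennreal e"
    and F: "\<And>e. e > 0 \<Longrightarrow> \<exists>\<delta>>0. \<forall>a r. r > 0 \<longrightarrow> (\<forall>z\<in>cube a r. norm z > \<delta>) \<longrightarrow> osc \<omega> f a r \<le> ennreal e"
    and e: "e > 0"
  shows "\<exists>r>0. \<forall>x y. x \<noteq> y \<longrightarrow> norm x \<ge> r \<longrightarrow> norm (rep x - rep y) \<le> e * \<omega> (norm (x - y))"
proof -
  define E where "E = e / (2 * K)"
  have E: "E > 0" using e K_pos by (simp add: E_def)
  obtain M where M: "M > 0" "\<And>a r. r \<ge> M \<Longrightarrow> osc \<omega> f a r \<le> ennreal E" using L[OF E] by blast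
  obtain \<delta> where \<delta>: "\<delta> > 0" "\<And>a r. r > 0 \<Longrightarrow> (\<And>z. z \<in> cube a r \<Longrightarrow> norm z > \<delta>) \<Longrightarrow> osc \<omega> f a r \<le> ennreal E"
    using F[OF E] by blast
  \<comment> \<open>From \<open>T\<close> on, half of \<open>e * \<omega>\<close> pays for the
    constant; the choice of \<open>E\<close> makes \<open>K * E\<close> the other half.\<close>
  obtain T where T: "T > 0" "\<And>t. T \<le> t \<Longrightarrow> 2 * P * D * B * \<omega> M / (e / 2) \<le> \<omega> t" using large_ex by blast
  define N where "N = max M T"
  \<comment> \<open>Points of the relevant cubes are at most \<open>CARD('n) * (2 * N)\<close> away
    from \<open>x\<close>; the summand 1 makes their distance to the origin strictly larger than
    \<open>\<delta>\<close>.\<close>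
  define r where "r = \<delta> + real CARD('n) * (2 * N) + 1"
  have "norm (rep x - rep y) \<le> e * \<omega> (norm (x - y))" if xy: "x \<noteq> y" "norm x \<ge> r" for x y
  proof (cases "norm (x - y) \<ge> N")
    case True
    have "norm (rep x - rep y) \<le> 2 * P * D * B * \<omega> M + K * E * \<omega> (norm (x - y))"
      using True M E by (intro rep_modulus_large) (auto simp: N_def)
    moreover have "2 * P * D * B * \<omega> M \<le> e / 2 * \<omega> (norm (x - y))"
      using T(2)[of "norm (x - y)"] True e by (simp add: N_def field_simps)
    moreover have "K * E * \<omega> (norm (x - y)) = e / 2 * \<omega> (norm (x - y))" using K_pos by (simp add: E_def)
    ultimately show ?thesis by linarith
  next
    case False
    let ?c = "\<chi> i. min (x $ i) (y $ i)"
    have "norm (rep x - rep y) \<le> K * E * \<omega> (norm (x - y))"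
    proof (intro rep_modulus xy \<delta>)
      fix b s z assume "0 < s" and s: "cube b s \<subseteq> cube ?c (2 * norm (x - y))" and z: "z \<in> cube b s"
      have "x \<in> cube ?c (2 * norm (x - y))"
        using component_min_cube(1)[of x y] cube_subset[of ?c ?c "norm (x - y)" "2 * norm (x - y)"] by auto
      then have "norm (x - z) \<le> real CARD('n) * (2 * norm (x - y))"
        using s z by (intro norm_diff_cube) auto
      also have "\<dots> \<le> real CARD('n) * (2 * N)" using False by (intro mult_left_mono) auto
      finally show "\<delta> < norm z"
        using norm_triangle_sub[of x z] xy(2) by (simp add: r_def)
    qed (use E in auto)
    also have "\<dots> \<le> e * \<omega> (norm (x - y))"
      using K_pos e xy nonneg[of "norm (x - y)"] by (intro mult_right_mono) (auto simp: E_def)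
    finally show ?thesis .
  qed
  moreover have "r > 0" using \<delta>(1) M(1) by (simp add: r_def N_def add_pos_pos)
  ultimately show ?thesis by blast
qed

end

section \<open>Cutting off at a large radius\<close>

context gauge
begin

lemma ratio_ex:
  assumes "e > 0"
  obtains d where "d > 0" "\<And>t. 0 < t \<Longrightarrow> t \<le> d \<Longrightarrow> t \<le> e * \<omega> t"
proof -
  have "\<forall>\<^sub>F t in at_right 0. t / \<omega> t < e" using lim_ratio assms by (rule order_tendstoD(2))
  then obtain b where b: "b > 0" "\<And>t. 0 < t \<Longrightarrow> t < b \<Longrightarrow> t / \<omega> t < e"
    unfolding eventually_at_right_field by auto
  have "t \<le> e * \<omega> t" if "0 < t" "t \<le> b / 2" for t
    using b(2)[of t] b(1) that pos[of t] by (simp add: pos_divide_less_eq)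
  then show ?thesis using b(1) by (intro that[of "b / 2"]) auto
qed

text \<open>
  Nothing forces \<open>\<omega> t / t\<close> to be almost decreasing for large \<open>t\<close>, so \<open>R * \<omega> d / d\<close> need not
  dominate \<open>\<omega> R\<close> when \<open>d < R\<close>; the cut-off at scale \<open>R\<close> only needs that it dominates constants.
\<close>

lemma linear_growth_ex:
  obtains R where "R > 0" "\<And>R' d. R \<le> R' \<Longrightarrow> 0 < d \<Longrightarrow> d \<le> R' \<Longrightarrow> q \<le> R' * \<omega> d / d"
proof -
  obtain t0 where t0: "t0 > 0" "\<And>t. 0 < t \<Longrightarrow> t \<le> t0 \<Longrightarrow> t \<le> 1 * \<omega> t" using ratio_ex[of 1] by auto
  obtain T where T: "T > 0" "\<And>t. T \<le> t \<Longrightarrow> q \<le> \<omega> t" using large_ex by blast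
  \<comment> \<open>A positive lower bound for \<open>\<omega> d / d\<close> on
    \<open>0 < d \<le> T\<close>: near 0 the ratio is at least 1, and from \<open>t0\<close> to
    \<open>T\<close> monotonicity gives \<open>\<omega> t0 / T\<close>. For \<open>d > T\<close>
    already \<open>\<omega> d \<ge> q\<close>, and the factor \<open>R' / d\<close> is at least
    1.\<close>
  define c where "c = min 1 (\<omega> t0 / T)"
  have c: "c > 0" using T(1) t0(1) pos[of t0] by (simp add: c_def)
  have cd: "c \<le> \<omega> d / d" if "0 < d" "d \<le> T" for d
  proof (cases "d \<le> t0")
    case True
    then have "1 \<le> \<omega> d / d" using t0(2)[of d] that by simp
    then show ?thesis by (simp add: c_def)
  next
    case False
    have "\<omega> t0 / T \<le> \<omega> d / d"
      using False that t0(1) nonneg[of d] by (intro frac_le mono) auto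
    then show ?thesis by (simp add: c_def)
  qed
  have "q \<le> R' * \<omega> d / d" if "max T (q / c) \<le> R'" "0 < d" "d \<le> R'" for R' d
  proof (cases "d \<le> T")
    case True
    have "q \<le> R' * c" using that(1) c by (simp add: field_simps)
    also have "\<dots> \<le> R' * (\<omega> d / d)" using that T(1) by (intro mult_left_mono cd True) auto
    finally show ?thesis by simp
  next
    case False
    then have "q \<le> 1 * \<omega> d" using T(2)[of d] by simp
    also have "\<dots> \<le> R' / d * \<omega> d" using that nonneg[of d] by (intro mult_right_mono) auto
    finally show ?thesis by simp
  qed
  then show ?thesis using T(1) by (intro that[of "max T (q / c)"]) auto
qed

text \<open>A single use of the global modulus would put the large constant \<open>A\<close> in
  front of \<open>\<omega> (norm y)\<close>. Along the segment from 0 to \<open>y\<close>,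
  \<open>A\<close> is paid only inside the ball of radius \<open>r\<close>; each step outside costs
  \<open>e * \<omega> d\<close>.\<close>

lemma chain_bound:
  fixes u :: "'a::real_normed_vector \<Rightarrow> 'b::real_normed_vector"
  assumes u0: "u 0 = 0" and A: "A \<ge> 0" "\<And>x y. x \<noteq> y \<Longrightarrow> norm (u x - u y) \<le> A * \<omega> (norm (x - y))"
    and e: "e > 0" and r: "r > 0"
    and far: "\<And>x y. x \<noteq> y \<Longrightarrow> norm x \<ge> r \<Longrightarrow> norm (u x - u y) \<le> e * \<omega> (norm (x - y))"
    and d: "0 < d" "d \<le> R" and y: "norm y \<le> 2 * R"
  shows "norm (u y) \<le> A * \<omega> r + 3 * e * (R * \<omega> d / d)"
proof (cases "y = 0")
  case True
  then show ?thesis using u0 A(1) e d r nonneg[of r] nonneg[of d] by simp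
next
  case False
  define N where "N = nat \<lceil>2 * R / d\<rceil>"
  have R: "R > 0" using d by simp
  have Nge: "real N \<ge> 2 * R / d" unfolding N_def by (rule real_nat_ceiling_ge)
  have N0: "real N > 0" using Nge R d by (smt (verit) divide_pos_pos)
  \<comment> \<open>Rounding up adds less than one step, and \<open>1 \<le> R / d\<close> turns
    \<open>2 * R / d + 1\<close> into \<open>3 * (R / d)\<close>.\<close>
  have "real N \<le> 2 * R / d + 1"
    using R d of_int_ceiling_le_add_one[of "2 * R / d"] by (simp add: N_def)
  also have "\<dots> \<le> 3 * (R / d)" using d by (simp add: field_simps)
  finally have Nle: "real N \<le> 3 * (R / d)" .
  define p where "p i = (real i / real N) *\<^sub>R y" for i
  have step: "norm (p (Suc i) - p i) \<le> d" "p (Suc i) \<noteq> p i" for i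
  proof -
    have *: "p (Suc i) - p i = (1 / real N) *\<^sub>R y"
      unfolding p_def by (simp add: scaleR_diff_left[symmetric] diff_divide_distrib[symmetric])
    have "norm y / real N \<le> 2 * R / (2 * R / d)"
      using y Nge R d N0 by (intro frac_le) auto
    then show "norm (p (Suc i) - p i) \<le> d" using R d unfolding * by simp
    show "p (Suc i) \<noteq> p i" using * False N0 by auto
  qed
  \<comment> \<open>A point inside the ball of radius \<open>r\<close> is estimated afresh from
    \<open>u 0 = 0\<close>; a point outside adds one step to the bound of its predecessor.\<close>
  have ind: "norm (u (p i)) \<le> A * \<omega> r + real i * (e * \<omega> d)" for i
  proof (induction i)
    case 0
    then show ?case using A(1) nonneg[OF r] by (simp add: p_def u0)
  next
    case (Suc i)
    show ?case
    proof (cases "norm (p (Suc i)) \<ge> r")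
      case True
      have "norm (u (p (Suc i)) - u (p i)) \<le> e * \<omega> (norm (p (Suc i) - p i))"
        by (intro far step True)
      also have "\<dots> \<le> e * \<omega> d"
        using step[of i] e by (intro mult_left_mono mono) auto
      finally show ?thesis
        using Suc norm_triangle_sub[of "u (p (Suc i))" "u (p i)"] by (simp add: algebra_simps)
    next
      case False
      have "norm (u (p (Suc i))) \<le> A * \<omega> r"
      proof (cases "p (Suc i) = 0")
        case True
        then show ?thesis using A(1) nonneg[OF r] by (simp add: u0)
      next
        case n0: False
        have "norm (u (p (Suc i)) - u 0) \<le> A * \<omega> (norm (p (Suc i) - 0))"
          using n0 by (intro A)
        also have "\<dots> \<le> A * \<omega> r" using n0 False A(1) by (intro mult_left_mono mono) auto
        finally show ?thesis by (simp add: u0)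
      qed
      also have "\<dots> \<le> A * \<omega> r + real (Suc i) * (e * \<omega> d)"
        using e nonneg[OF d(1)] by simp
      finally show ?thesis .
    qed
  qed
  have "p N = y" using N0 by (simp add: p_def)
  then have "norm (u y) \<le> A * \<omega> r + real N * (e * \<omega> d)" using ind[of N] by simp
  also have "\<dots> \<le> A * \<omega> r + 3 * (R / d) * (e * \<omega> d)"
    using Nle e nonneg[OF d(1)] by (intro add_left_mono mult_right_mono) auto
  finally show ?thesis by (simp add: mult_ac)
qed

text \<open>By symmetry let \<open>y\<close> be the point nearer to the origin. In the product rule
  the factor \<open>ramp R x\<close> vanishes unless \<open>norm x > R \<ge> r\<close>, where
  \<open>far\<close> gives \<open>e\<close>; the difference of ramps, at most \<open>d / R\<close>,
  meets \<open>norm (u y) \<le> 4 * e * (R * \<omega> d / d)\<close>. Together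
  \<open>1 + 4 = 5\<close>.\<close>

lemma cutoff_modulus:
  fixes u :: "'a::real_normed_vector \<Rightarrow> 'b::real_normed_vector"
  assumes u0: "u 0 = 0" and A: "A \<ge> 0" "\<And>x y. x \<noteq> y \<Longrightarrow> norm (u x - u y) \<le> A * \<omega> (norm (x - y))"
    and e: "e > 0" and r: "r > 0"
    and far: "\<And>x y. x \<noteq> y \<Longrightarrow> norm x \<ge> r \<Longrightarrow> norm (u x - u y) \<le> e * \<omega> (norm (x - y))"
  shows "\<exists>R>0. \<forall>x y. x \<noteq> y \<longrightarrow> norm (ramp R x *\<^sub>R u x - ramp R y *\<^sub>R u y) \<le> 5 * e * \<omega> (norm (x - y))"
proof -
  \<comment> \<open>Beyond \<open>R0\<close> the constant \<open>A * \<omega> r\<close> of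
    \<open>chain_bound\<close> is at most one more \<open>e * (R * \<omega> d / d)\<close>, which
    makes the factor 3 there a 4.\<close>
  obtain R0 where R0: "R0 > 0" "\<And>R' d. R0 \<le> R' \<Longrightarrow> 0 < d \<Longrightarrow> d \<le> R' \<Longrightarrow> A * \<omega> r / e \<le> R' * \<omega> d / d"
    using linear_growth_ex by blast
  define R where "R = max R0 r"
  have R: "R > 0" "R0 \<le> R" "r \<le> R" using R0(1) by (auto simp: R_def)
  have ub: "norm (u y) \<le> 4 * e * (R * \<omega> d / d)" if "0 < d" "d \<le> R" "norm y \<le> 2 * R" for y d
  proof -
    define Z where "Z = R * \<omega> d / d"
    have "norm (u y) \<le> A * \<omega> r + 3 * e * Z"
      unfolding Z_def by (rule chain_bound[OF u0 A e r far that])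
    moreover have "A * \<omega> r \<le> e * Z"
      using R0(2)[OF R(2) that(1,2)] e unfolding Z_def by (simp add: pos_divide_le_eq mult.commute)
    ultimately show ?thesis unfolding Z_def[symmetric] by (simp add: algebra_simps)
  qed
  have main: "norm (ramp R x *\<^sub>R u x - ramp R y *\<^sub>R u y) \<le> 5 * e * \<omega> (norm (x - y))"
    if xy: "x \<noteq> y" "norm y \<le> norm x" for x y
  proof (cases "norm x \<le> R")
    case True
    then have "ramp R x = 0" "ramp R y = 0" using xy R by (auto intro: ramp_0)
    then show ?thesis using e xy nonneg[of "norm (x - y)"] by simp
  next
    case False
    let ?d = "norm (x - y)"
    have d: "?d > 0" using xy by simp
    have "ramp R x *\<^sub>R u x - ramp R y *\<^sub>R u y = ramp R x *\<^sub>R (u x - u y) + (ramp R x - ramp R y) *\<^sub>R u y"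
      by (simp add: algebra_simps)
    then have "norm (ramp R x *\<^sub>R u x - ramp R y *\<^sub>R u y) \<le>
        ramp R x * norm (u x - u y) + \<bar>ramp R x - ramp R y\<bar> * norm (u y)"
      using norm_triangle_ineq[of "ramp R x *\<^sub>R (u x - u y)" "(ramp R x - ramp R y) *\<^sub>R u y"]
      by (simp add: ramp_bounds)
    moreover have "ramp R x * norm (u x - u y) \<le> 1 * (e * \<omega> ?d)"
      using False R xy by (intro mult_mono far ramp_bounds) auto
    moreover have "\<bar>ramp R x - ramp R y\<bar> * norm (u y) \<le> 4 * e * \<omega> ?d"
    proof (cases "norm y \<ge> 2 * R")
      case True
      then have "ramp R x = 1" "ramp R y = 1" using xy R by (auto intro: ramp_1)
      then show ?thesis using e nonneg[OF d] by simp
    next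
      case yR: False
      show ?thesis
      proof (cases "?d \<le> R")
        case True
        have "\<bar>ramp R x - ramp R y\<bar> * norm (u y) \<le> ?d / R * (4 * e * (R * \<omega> ?d / ?d))"
          using yR True d R by (intro mult_mono ramp_lipschitz ub) auto
        also have "\<dots> = 4 * e * \<omega> ?d" using R d by simp
        finally show ?thesis .
      next
        case False
        \<comment> \<open>For distances above \<open>R\<close> the chain is run with step
          \<open>R\<close>, and monotonicity replaces \<open>\<omega> R\<close> by
          \<open>\<omega>\<close> at the distance.\<close>
        have "\<bar>ramp R x - ramp R y\<bar> \<le> 1"
          using ramp_bounds[of R x] ramp_bounds[of R y] by linarith
        then have "\<bar>ramp R x - ramp R y\<bar> * norm (u y) \<le> 1 * (4 * e * (R * \<omega> R / R))"
          using yR R by (intro mult_mono ub) auto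
        also have "\<dots> \<le> 4 * e * \<omega> ?d" using R False e mono[of R ?d] by simp
        finally show ?thesis .
      qed
    qed
    ultimately show ?thesis by linarith
  qed
  have "norm (ramp R x *\<^sub>R u x - ramp R y *\<^sub>R u y) \<le> 5 * e * \<omega> (norm (x - y))" if "x \<noteq> y" for x y
    using main[of x y] main[of y x] that by (cases "norm y \<le> norm x") (auto simp: norm_minus_commute)
  then show ?thesis using R(1) by blast
qed

text \<open>A Lipschitz factor does no harm at small scales: on the ball of radius
  \<open>3 * R\<close> the function is bounded by some \<open>M\<close>, and
  \<open>t * M / R\<close> is at most \<open>e / 2 * \<omega> t\<close> for small \<open>t\<close>.
  If \<open>norm y > 3 * R\<close>, the requirement \<open>d \<le> R\<close> leaves both points
  where the ramp is 1.\<close>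

lemma truncation_modulus_small:
  fixes u :: "'a::euclidean_space \<Rightarrow> 'b::real_normed_vector"
  assumes cont: "continuous_on UNIV u"
    and small: "\<And>e. e > 0 \<Longrightarrow> \<exists>d>0. \<forall>x y. x \<noteq> y \<longrightarrow> norm (x - y) \<le> d \<longrightarrow> norm (u x - u y) \<le> e * \<omega> (norm (x - y))"
    and R: "R > 0" and e: "e > 0"
  shows "\<exists>d>0. \<forall>x y. x \<noteq> y \<longrightarrow> norm (x - y) \<le> d \<longrightarrow>
    norm ((1 - ramp R x) *\<^sub>R u x - (1 - ramp R y) *\<^sub>R u y) \<le> e * \<omega> (norm (x - y))"
proof -
  have "bounded (u ` cball 0 (3 * R))"
    by (intro compact_imp_bounded compact_continuous_image continuous_on_subset[OF cont]) auto
  then obtain M where M: "M > 0" "\<And>x. norm x \<le> 3 * R \<Longrightarrow> norm (u x) \<le> M"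
    unfolding bounded_pos by auto
  obtain d1 where d1: "d1 > 0" "\<And>x y. x \<noteq> y \<Longrightarrow> norm (x - y) \<le> d1 \<Longrightarrow> norm (u x - u y) \<le> e / 2 * \<omega> (norm (x - y))"
    using small[of "e / 2"] e by auto
  obtain d2 where d2: "d2 > 0" "\<And>t. 0 < t \<Longrightarrow> t \<le> d2 \<Longrightarrow> t \<le> e * R / (2 * M) * \<omega> t"
    using ratio_ex[of "e * R / (2 * M)"] e R M(1) by auto
  define d where "d = min R (min d1 d2)"
  have "norm ((1 - ramp R x) *\<^sub>R u x - (1 - ramp R y) *\<^sub>R u y) \<le> e * \<omega> (norm (x - y))"
    if xy: "x \<noteq> y" "norm (x - y) \<le> d" for x y
  proof -
    let ?d = "norm (x - y)"
    have d: "?d > 0" using xy by simp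
    have "(1 - ramp R x) *\<^sub>R u x - (1 - ramp R y) *\<^sub>R u y =
        (1 - ramp R x) *\<^sub>R (u x - u y) + (ramp R y - ramp R x) *\<^sub>R u y"
      by (simp add: algebra_simps)
    then have "norm ((1 - ramp R x) *\<^sub>R u x - (1 - ramp R y) *\<^sub>R u y) \<le>
        (1 - ramp R x) * norm (u x - u y) + \<bar>ramp R y - ramp R x\<bar> * norm (u y)"
      using norm_triangle_ineq[of "(1 - ramp R x) *\<^sub>R (u x - u y)" "(ramp R y - ramp R x) *\<^sub>R u y"]
      by (simp add: ramp_bounds)
    moreover have "(1 - ramp R x) * norm (u x - u y) \<le> 1 * (e / 2 * \<omega> ?d)"
      using xy by (intro mult_mono d1) (auto simp: ramp_bounds d_def)
    moreover have "\<bar>ramp R y - ramp R x\<bar> * norm (u y) \<le> e / 2 * \<omega> ?d"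
    proof (cases "norm y \<le> 3 * R")
      case True
      have "\<bar>ramp R y - ramp R x\<bar> * norm (u y) \<le> ?d / R * M"
        using ramp_lipschitz[OF R, of y x] M(2)[OF True] M(1) R
        by (intro mult_mono) (auto simp: norm_minus_commute)
      also have "\<dots> \<le> (e * R / (2 * M) * \<omega> ?d) / R * M"
        using d2(2)[OF d] xy R M(1) by (intro mult_right_mono divide_right_mono) (auto simp: d_def)
      also have "\<dots> = e / 2 * \<omega> ?d" using R M(1) by simp
      finally show ?thesis .
    next
      case False
      then have "norm x \<ge> 2 * R"
        using xy(2) norm_triangle_ineq3[of x y] abs_ge_minus_self[of "norm x - norm y"] by (simp add: d_def)
      then have "ramp R x = 1" "ramp R y = 1" using False R by (auto intro: ramp_1)
      then show ?thesis using e nonneg[OF d] by simp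
    qed
    ultimately show ?thesis by simp
  qed
  moreover have "d > 0" using R d1(1) d2(1) by (simp add: d_def)
  ultimately show ?thesis by blast
qed

end

section \<open>Smooth kernels\<close>

lemma C_k_continuous: "C_k k f \<Longrightarrow> continuous_on UNIV f"
proof (cases k)
  case (Suc j)
  assume "C_k k f"
  then show ?thesis
    using Suc by (intro differentiable_imp_continuous_on) (auto simp: differentiable_on_def differentiable_at_withinI)
qed simp

lemma C_k_SucD: "C_k (Suc k) f \<Longrightarrow> C_k k f"
proof (induction k arbitrary: f)
  case 0
  from C_k_continuous[OF this] show ?case by simp
next
  case (Suc k)
  have "(\<forall>x. f differentiable (at x)) \<and> (\<forall>v. C_k (Suc k) (\<lambda>x. frechet_derivative f (at x) v))"
    using Suc.prems unfolding C_k.simps(2)[of "Suc k"] .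
  then show ?case using Suc.IH by (auto simp del: C_k.simps(2) simp: C_k.simps(2)[of k])
qed

lemma C_k_SucI:
  assumes "\<And>x. (f has_derivative f' x) (at x)" "\<And>v. C_k k (\<lambda>x. f' x v)"
  shows "C_k (Suc k) f"
proof -
  have "frechet_derivative f (at x) = f' x" for x
    using frechet_derivative_at[OF assms(1)] by simp
  then show ?thesis using assms by (auto simp: differentiable_def)
qed

lemma C_k_frechet: "C_k (Suc k) f \<Longrightarrow> (f has_derivative frechet_derivative f (at x)) (at x)"
  by (simp add: frechet_derivative_works)

lemma C_k_const: "C_k k (\<lambda>_. c)"
proof (induction k arbitrary: c)
  case (Suc k)
  show ?case by (rule C_k_SucI[where f' = "\<lambda>_ _. 0"]) (auto intro: Suc)
qed simp

lemma C_k_add: "C_k k f \<Longrightarrow> C_k k g \<Longrightarrow> C_k k (\<lambda>x. f x + g x)"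
proof (induction k arbitrary: f g)
  case (Suc k)
  show ?case
  proof (rule C_k_SucI)
    show "((\<lambda>x. f x + g x) has_derivative (\<lambda>v. frechet_derivative f (at x) v + frechet_derivative g (at x) v)) (at x)" for x
      by (intro has_derivative_add C_k_frechet[OF Suc.prems(1)] C_k_frechet[OF Suc.prems(2)])
    show "C_k k (\<lambda>x. frechet_derivative f (at x) v + frechet_derivative g (at x) v)" for v
      using Suc.prems by (intro Suc.IH) auto
  qed
qed (auto intro: continuous_intros)

lemma C_k_mult:
  fixes f g :: "'a::euclidean_space \<Rightarrow> real"
  shows "C_k k f \<Longrightarrow> C_k k g \<Longrightarrow> C_k k (\<lambda>x. f x * g x)"
proof (induction k arbitrary: f g)
  case (Suc k)
  show ?case
  proof (rule C_k_SucI)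
    show "((\<lambda>x. f x * g x) has_derivative (\<lambda>v. f x * frechet_derivative g (at x) v + frechet_derivative f (at x) v * g x)) (at x)" for x
      by (intro has_derivative_mult C_k_frechet[OF Suc.prems(1)] C_k_frechet[OF Suc.prems(2)])
    show "C_k k (\<lambda>x. f x * frechet_derivative g (at x) v + frechet_derivative f (at x) v * g x)" for v
      using Suc.prems C_k_SucD[OF Suc.prems(1)] C_k_SucD[OF Suc.prems(2)]
      by (intro C_k_add Suc.IH) auto
  qed
qed (auto intro: continuous_intros)

lemma C_k_inner: "C_k k (\<lambda>x. x \<bullet> v)"
proof (cases k)
  case (Suc j)
  have "C_k (Suc j) (\<lambda>x. x \<bullet> v)"
    by (rule C_k_SucI[where f' = "\<lambda>_ w. w \<bullet> v"]) (auto intro!: derivative_eq_intros C_k_const)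
  then show ?thesis using Suc by simp
qed (auto intro!: continuous_intros)

text \<open>The classical flat function, multiplied by a polynomial in \<open>1 / t\<close>. This
  family is closed under differentiation, so smoothness of all orders follows by one induction over
  arbitrary \<open>p\<close>.\<close>

definition exp_bump :: "real poly \<Rightarrow> real \<Rightarrow> real" where
  "exp_bump p t = (if t > 0 then poly p (1 / t) * exp (- (1 / t)) else 0)"

lemma poly_div_exp_tendsto_0: "((\<lambda>s::real. poly p s * exp (- s)) \<longlongrightarrow> 0) at_top"
proof -
  have "((\<lambda>s::real. \<Sum>i\<le>degree p. coeff p i * (s ^ i / exp s)) \<longlongrightarrow> (\<Sum>i\<le>degree p. coeff p i * 0)) at_top"
    by (intro tendsto_intros tendsto_power_div_exp_0)
  moreover have "poly p s * exp (- s) = (\<Sum>i\<le>degree p. coeff p i * (s ^ i / exp s))" for s :: real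
    by (simp add: poly_altdef exp_minus sum_distrib_right divide_inverse mult.assoc)
  ultimately show ?thesis by simp
qed

lemma exp_bump_tendsto_0: "(exp_bump p \<longlongrightarrow> 0) (at 0)"
proof -
  have "(exp_bump p \<longlongrightarrow> 0) (at_left 0)"
    by (rule tendsto_eventually) (auto simp: exp_bump_def eventually_at_filter)
  moreover have "((\<lambda>t. poly p (inverse t) * exp (- inverse t)) \<longlongrightarrow> 0) (at_right 0)"
    by (rule filterlim_compose[OF poly_div_exp_tendsto_0 filterlim_inverse_at_top_right])
  then have "(exp_bump p \<longlongrightarrow> 0) (at_right 0)"
    by (rule Lim_transform_eventually) (auto simp: exp_bump_def eventually_at_filter divide_inverse)
  ultimately show ?thesis by (rule filterlim_split_at)
qed

lemma exp_bump_DERIV: "(exp_bump p has_real_derivative exp_bump ([:0, 0, 1:] * (p - pderiv p)) t) (at t)"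
proof -
  consider "t > 0" | "t < 0" | "t = 0" by linarith
  then show ?thesis
  proof cases
    case 1
    have "((\<lambda>t. poly p (1 / t) * exp (- (1 / t))) has_real_derivative
        poly ([:0, 0, 1:] * (p - pderiv p)) (1 / t) * exp (- (1 / t))) (at t)"
      using 1 by (auto intro!: derivative_eq_intros DERIV_chain'[OF _ poly_DERIV, of "\<lambda>t. 1 / t"]
          simp: field_simps power2_eq_square)
    then have "(exp_bump p has_real_derivative poly ([:0, 0, 1:] * (p - pderiv p)) (1 / t) * exp (- (1 / t))) (at t)"
      by (rule has_field_derivative_transform_within_open[where S = "{0<..}"]) (use 1 in \<open>auto simp: exp_bump_def\<close>)
    then show ?thesis using 1 by (simp add: exp_bump_def)
  next
    case 2
    have "(exp_bump p has_real_derivative 0) (at t)"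
      by (rule has_field_derivative_transform_within_open[where S = "{..<0}" and f = "\<lambda>_. 0"])
        (use 2 in \<open>auto simp: exp_bump_def\<close>)
    then show ?thesis using 2 by (simp add: exp_bump_def)
  next
    case 3
    \<comment> \<open>Dividing by \<open>h\<close> multiplies the polynomial by its variable: the
      difference quotient at 0 is again in the family and tends to 0.\<close>
    have "(exp_bump p (0 + h) - exp_bump p 0) / h = exp_bump (pCons 0 p) h" for h
      by (simp add: exp_bump_def)
    then have "((\<lambda>h. (exp_bump p (0 + h) - exp_bump p 0) / h) \<longlongrightarrow> 0) (at 0)"
      using exp_bump_tendsto_0[of "pCons 0 p"] by (simp only:)
    moreover have "exp_bump q 0 = 0" for q by (simp add: exp_bump_def)
    ultimately show ?thesis using 3 by (simp only: DERIV_def)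
  qed
qed

lemma C_k_exp_bump: "C_k k (\<lambda>x::'a::euclidean_space. exp_bump p (r - x \<bullet> x))"
proof (induction k arbitrary: p)
  case 0
  have "continuous_on UNIV (exp_bump p)"
    by (intro DERIV_continuous_on[where D = "\<lambda>t. exp_bump ([:0, 0, 1:] * (p - pderiv p)) t"])
      (rule has_field_derivative_at_within[OF exp_bump_DERIV])
  then show ?case
    by (auto intro!: continuous_intros elim: continuous_on_compose2)
next
  case (Suc k)
  let ?q = "[:0, 0, 1:] * (p - pderiv p)"
  show ?case
  proof (rule C_k_SucI)
    show "((\<lambda>x::'a. exp_bump p (r - x \<bullet> x)) has_derivative
        (\<lambda>v. exp_bump ?q (r - x \<bullet> x) * (- 2 * (x \<bullet> v)))) (at x)" for x
    proof -
      have "((\<lambda>x::'a. r - x \<bullet> x) has_derivative (\<lambda>v. - 2 * (x \<bullet> v))) (at x)"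
        by (auto intro!: derivative_eq_intros simp: inner_commute)
      from has_derivative_compose[OF this, of "exp_bump p" "\<lambda>h. exp_bump ?q (r - x \<bullet> x) * h"] show ?thesis
        using exp_bump_DERIV[of p "r - x \<bullet> x"] by (simp add: has_field_derivative_def)
    qed
    show "C_k k (\<lambda>x::'a. exp_bump ?q (r - x \<bullet> x) * (- 2 * (x \<bullet> v)))" for v
      by (intro C_k_mult Suc.IH C_k_const C_k_inner)
  qed
qed

text \<open>\<open>x \<bullet> x\<close> is smooth at the origin where the norm is not. The bump is
  continuous, nonnegative and nonzero at 0, so its integral is positive and can be
  normalised.\<close>

lemma smooth_kernel_ex:
  assumes \<rho>: "\<rho> > 0"
  obtains \<phi> :: "'a::euclidean_space \<Rightarrow> real" where "\<And>k. C_k k \<phi>" "\<And>x. \<phi> x \<ge> 0"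
    "\<And>x. norm x \<ge> \<rho> \<Longrightarrow> \<phi> x = 0" "(\<phi> has_integral 1) UNIV"
proof -
  define \<psi> where "\<psi> x = exp_bump [:1:] (\<rho>\<^sup>2 - x \<bullet> x)" for x :: 'a
  have \<psi>: "\<And>k. C_k k \<psi>" "\<And>x. \<psi> x \<ge> 0"
    unfolding \<psi>_def by (rule C_k_exp_bump) (simp add: exp_bump_def)
  have supp: "\<psi> x = 0" if "norm x \<ge> \<rho>" for x
    using power_mono[OF that, of 2] \<rho> by (simp add: \<psi>_def exp_bump_def dot_square_norm not_less)
  have "bounded (cball (0::'a) \<rho>)" by simp
  then obtain a where a: "cball (0::'a) \<rho> \<subseteq> cbox (-a) a"
    using bounded_subset_cbox_symmetric by blast
  define I where "I = integral (cbox (-a) a) \<psi>"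
  have cont: "continuous_on S \<psi>" for S
    using C_k_continuous[OF \<psi>(1)[of 0]] continuous_on_subset by blast
  have int: "(\<psi> has_integral I) (cbox (-a) a)"
    unfolding I_def by (intro integrable_integral integrable_continuous cont)
  have "\<psi> x = 0" if "x \<notin> cbox (-a) a" for x
    using that a by (intro supp) (force simp: mem_cball)
  then have U: "(\<psi> has_integral I) UNIV"
    by (rule has_integral_on_superset[OF int]) auto
  have 0: "(0::'a) \<in> box (-a) a"
  proof -
    have "ball (0::'a) \<rho> \<subseteq> interior (cbox (-a) a)"
      using a by (intro interior_maximal) auto
    then show ?thesis using \<rho> by (auto simp: interior_cbox)
  qed
  have "\<psi> 0 \<noteq> 0" using \<rho> by (simp add: \<psi>_def exp_bump_def)
  then have "I \<noteq> 0"
    unfolding I_def using 0 box_subset_cbox[of "-a" a] \<psi>(2)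
    by (subst integral_cbox_eq_0_iff) (auto intro!: cont)
  moreover have "I \<ge> 0" unfolding I_def by (intro integral_nonneg integrable_continuous cont \<psi>)
  ultimately have I: "I > 0" by simp
  show ?thesis
  proof (rule that[of "\<lambda>x. 1 / I * \<psi> x"])
    show "((\<lambda>x. 1 / I * \<psi> x) has_integral 1) UNIV"
      using has_integral_mult_right[OF U, of "1 / I"] I by simp
    show "C_k k (\<lambda>x. 1 / I * \<psi> x)" for k
      by (intro C_k_mult C_k_const \<psi>)
  qed (use I \<psi> supp in auto)
qed

section \<open>Mollification\<close>

text \<open>All derivatives fall on \<open>\<phi>\<close>. A directional derivative of the
  convolution is the convolution with the directional derivative of \<open>\<phi>\<close>, to which
  the induction hypothesis applies; \<open>g\<close> only has to be continuous.\<close>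

lemma C_k_convolution:
  fixes \<phi> :: "'a::euclidean_space \<Rightarrow> real" and g :: "'a \<Rightarrow> 'b::banach"
  assumes g: "continuous_on (cbox a b) g"
  shows "C_k k \<phi> \<Longrightarrow> C_k k (\<lambda>x. integral (cbox a b) (\<lambda>z. \<phi> (x - z) *\<^sub>R g z))"
proof (induction k arbitrary: \<phi>)
  case 0
  then have \<phi>: "continuous_on UNIV \<phi>" by simp
  have "continuous_on (UNIV \<times> cbox a b) (\<lambda>(x, z). \<phi> (x - z) *\<^sub>R g z)"
    unfolding split_beta
    by (intro continuous_intros continuous_on_compose2[OF \<phi>] continuous_on_compose2[OF g]) auto
  then show ?case by (simp add: integral_continuous_on_param)
next
  case (Suc k)
  let ?D = "\<lambda>x. frechet_derivative \<phi> (at x)"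
  \<comment> \<open>\<open>leibniz_rule\<close> wants the derivative as a continuous map into
    bounded linear operators; in finite dimension continuity on basis vectors suffices.\<close>
  let ?F = "\<lambda>x z. Blinfun (\<lambda>v. ?D (x - z) v *\<^sub>R g z)"
  have D: "(\<phi> has_derivative ?D x) (at x)" for x
    by (rule C_k_frechet[OF Suc.prems])
  have Dv: "C_k k (\<lambda>x. ?D x v)" for v using Suc.prems by simp
  have F: "blinfun_apply (?F x z) = (\<lambda>v. ?D (x - z) v *\<^sub>R g z)" for x z
    by (intro bounded_linear_Blinfun_apply bounded_linear_scaleR_const has_derivative_bounded_linear[OF D])
  have \<phi>: "continuous_on UNIV \<phi>" by (rule C_k_continuous[OF Suc.prems])
  have contF: "continuous_on (UNIV \<times> cbox a b) (\<lambda>(x, z). ?F x z)"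
    unfolding split_beta
  proof (rule continuous_on_blinfun_componentwise)
    fix i :: 'a
    show "continuous_on (UNIV \<times> cbox a b) (\<lambda>p. blinfun_apply (?F (fst p) (snd p)) i)"
      unfolding F
      by (intro continuous_intros continuous_on_compose2[OF C_k_continuous[OF Dv[of i]]]
          continuous_on_compose2[OF g]) auto
  qed
  have contFx: "continuous_on (cbox a b) (?F x)" for x
  proof -
    have "continuous_on (cbox a b) (\<lambda>z. (x, z))" by (intro continuous_intros)
    from continuous_on_compose2[OF contF this] show ?thesis by auto
  qed
  show ?case
  proof (rule C_k_SucI)
    fix x
    have "((\<lambda>x. integral (cbox a b) (\<lambda>z. \<phi> (x - z) *\<^sub>R g z)) has_derivative
        blinfun_apply (integral (cbox a b) (?F x))) (at x within UNIV)"
    proof (rule leibniz_rule[OF _ _ contF])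
      fix x z
      show "((\<lambda>x. \<phi> (x - z) *\<^sub>R g z) has_derivative blinfun_apply (?F x z)) (at x within UNIV)"
        unfolding F
        by (intro has_derivative_scaleR_left has_derivative_compose[OF _ D, of "\<lambda>x. x - z" "\<lambda>v. v"])
          (auto intro!: derivative_eq_intros)
      show "(\<lambda>z. \<phi> (x - z) *\<^sub>R g z) integrable_on cbox a b"
        by (intro integrable_continuous continuous_intros continuous_on_compose2[OF \<phi>] g) auto
    qed auto
    moreover have "blinfun_apply (integral (cbox a b) (?F x)) = (\<lambda>v. integral (cbox a b) (\<lambda>z. ?D (x - z) v *\<^sub>R g z))"
    proof
      fix v
      show "blinfun_apply (integral (cbox a b) (?F x)) v = integral (cbox a b) (\<lambda>z. ?D (x - z) v *\<^sub>R g z)"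
      using integral_linear[OF integrable_continuous[OF contFx] blinfun.bounded_linear_left[of v]]
      by (simp add: o_def F)
    qed
    ultimately show "((\<lambda>x. integral (cbox a b) (\<lambda>z. \<phi> (x - z) *\<^sub>R g z)) has_derivative
        (\<lambda>v. integral (cbox a b) (\<lambda>z. ?D (x - z) v *\<^sub>R g z))) (at x)"
      by simp
  next
    show "C_k k (\<lambda>x. integral (cbox a b) (\<lambda>z. ?D (x - z) v *\<^sub>R g z))" for v
      by (rule Suc.IH[OF Dv])
  qed
qed

lemma kernel_average_norm_le:
  fixes \<phi> :: "'a::euclidean_space \<Rightarrow> real" and w :: "'a \<Rightarrow> 'b::banach"
  assumes \<phi>: "\<And>x. \<phi> x \<ge> 0" "\<And>x. norm x \<ge> \<rho> \<Longrightarrow> \<phi> x = 0" "(\<phi> has_integral 1) UNIV"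
    and I: "((\<lambda>z. \<phi> z *\<^sub>R w z) has_integral I) UNIV"
    and w: "\<And>z. norm z \<le> \<rho> \<Longrightarrow> norm (w z) \<le> c"
  shows "norm I \<le> c"
proof -
  have J: "((\<lambda>z. \<phi> z * c) has_integral 1 * c) UNIV"
    using \<phi>(3) by (rule has_integral_mult_left)
  have "norm (integral UNIV (\<lambda>z. \<phi> z *\<^sub>R w z)) \<le> integral UNIV (\<lambda>z. \<phi> z * c)"
  proof (rule integral_norm_bound_integral)
    fix z
    show "norm (\<phi> z *\<^sub>R w z) \<le> \<phi> z * c"
      using w[of z] \<phi>(1)[of z] \<phi>(2)[of z] by (cases "norm z \<le> \<rho>") (auto intro!: mult_left_mono)
  qed (use I J in \<open>auto simp: integrable_on_def\<close>)
  then show ?thesis unfolding integral_unique[OF I] integral_unique[OF J] by simp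
qed

text \<open>\<open>v\<close> is a weighted mean of translates of \<open>g\<close>, with weights of
  total mass 1 supported in the ball of radius \<open>\<rho>\<close>. The bounds are stated for an
  arbitrary \<open>c\<close>, so any translation invariant modulus of \<open>g\<close> passes to
  \<open>v\<close>.\<close>

lemma mollification_ex:
  fixes g :: "'a::euclidean_space \<Rightarrow> 'b::banach"
  assumes g: "continuous_on UNIV g" and supp: "\<And>x. norm x \<ge> r \<Longrightarrow> g x = 0" and \<rho>: "\<rho> > 0"
  obtains v where "v \<in> Cc_infinity"
    "\<And>x y c. (\<And>z. norm z \<le> \<rho> \<Longrightarrow> norm (g (x - z) - g (y - z)) \<le> c) \<Longrightarrow> norm (v x - v y) \<le> c"
    "\<And>x c. (\<And>z. norm z \<le> \<rho> \<Longrightarrow> norm (g (x - z) - g x) \<le> c) \<Longrightarrow> norm (v x - g x) \<le> c"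
proof -
  obtain \<phi> :: "'a \<Rightarrow> real" where \<phi>: "\<And>k. C_k k \<phi>" "\<And>x. \<phi> x \<ge> 0"
    "\<And>x. norm x \<ge> \<rho> \<Longrightarrow> \<phi> x = 0" "(\<phi> has_integral 1) UNIV"
    using smooth_kernel_ex[OF \<rho>] by blast
  have "bounded (cball (0::'a) r)" by simp
  then obtain a where a: "cball (0::'a) r \<subseteq> cbox (-a) a"
    using bounded_subset_cbox_symmetric by blast
  have g0: "g x = 0" if "x \<notin> cbox (-a) a" for x
    using that a by (intro supp) (force simp: mem_cball)
  have cont: "continuous_on S \<phi>" "continuous_on S g" for S
    using C_k_continuous[OF \<phi>(1)[of 0]] g continuous_on_subset by blast+
  define v where "v x = integral (cbox (-a) a) (\<lambda>z. \<phi> (x - z) *\<^sub>R g z)" for x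
  \<comment> \<open>Smoothness uses the form with \<open>x\<close> in the kernel over a fixed box;
    the estimates use this form, with the translation moved to \<open>g\<close>.\<close>
  have v: "((\<lambda>z. \<phi> z *\<^sub>R g (x - z)) has_integral v x) UNIV" for x
  proof -
    have "((\<lambda>z. \<phi> (x - z) *\<^sub>R g z) has_integral v x) (cbox (-a) a)"
      unfolding v_def
      by (intro integrable_integral integrable_continuous continuous_intros cont
          continuous_on_compose2[OF cont(1)[of UNIV]]) auto
    from has_integral_affinity[OF this, of "-1" x]
    have "((\<lambda>z. \<phi> z *\<^sub>R g (x - z)) has_integral v x) ((\<lambda>z. x - z) ` cbox (-a) a)"
      by (simp add: algebra_simps)
    then show ?thesis
    proof (rule has_integral_on_superset)
      fix z assume "z \<notin> (\<lambda>z. x - z) ` cbox (-a) a"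
      then have "x - z \<notin> cbox (-a) a" by (metis diff_diff_eq2 add_diff_cancel_left' image_eqI add.commute)
      then show "\<phi> z *\<^sub>R g (x - z) = 0" by (simp add: g0)
    qed simp
  qed
  show ?thesis
  proof (rule that[of v])
    have "bounded {x. v x \<noteq> 0}"
    proof (rule boundedI)
      fix x assume "x \<in> {x. v x \<noteq> 0}"
      then have "\<not> (\<forall>z\<in>cbox (-a) a. \<phi> (x - z) *\<^sub>R g z = 0)"
        unfolding v_def using integral_cong[of "cbox (-a) a" "\<lambda>z. \<phi> (x - z) *\<^sub>R g z" "\<lambda>_. 0"] by auto
      then obtain z where "\<phi> (x - z) \<noteq> 0" "g z \<noteq> 0" by auto
      then have "norm (x - z) < \<rho>" "norm z < r" using \<phi>(3)[of "x - z"] supp[of z] by fastforce+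
      then show "norm x \<le> \<rho> + r" using norm_triangle_sub[of x z] by simp
    qed
    moreover have "C_k k v" for k
      unfolding v_def by (intro C_k_convolution cont \<phi>)
    ultimately show "v \<in> Cc_infinity" by (simp add: Cc_infinity_def compact_closure)
  next
    fix x y c assume c: "\<And>z. norm z \<le> \<rho> \<Longrightarrow> norm (g (x - z) - g (y - z)) \<le> c"
    have "((\<lambda>z. \<phi> z *\<^sub>R (g (x - z) - g (y - z))) has_integral v x - v y) UNIV"
      using has_integral_diff[OF v[of x] v[of y]] by (simp add: scaleR_diff_right)
    from kernel_average_norm_le[OF \<phi>(2-4) this c] show "norm (v x - v y) \<le> c" .
  next
    fix x c assume c: "\<And>z. norm z \<le> \<rho> \<Longrightarrow> norm (g (x - z) - g x) \<le> c"
    have "((\<lambda>z. \<phi> z *\<^sub>R (g (x - z) - g x)) has_integral v x - 1 *\<^sub>R g x) UNIV"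
      using has_integral_diff[OF v[of x] has_integral_scaleR_left[OF \<phi>(4), of "g x"]] by (simp add: scaleR_diff_right)
    from kernel_average_norm_le[OF \<phi>(2-4) this c] show "norm (v x - g x) \<le> c" by simp
  qed
qed

section \<open>Smooth compactly supported maps have vanishing oscillation\<close>

text \<open>\<open>C_k\<close> yields continuity of the directional derivatives only, so the
  operator norm of the derivative is controlled by the sum \<open>N\<close> over the basis:
  \<open>N\<close> is bounded on the compact support, and the derivative vanishes off it.\<close>

lemma Cc_infinity_bounds:
  fixes g :: "'a::euclidean_space \<Rightarrow> 'b::banach"
  assumes "g \<in> Cc_infinity"
  obtains L M r where "L \<ge> 0" "M \<ge> 0" "\<And>x y. norm (g x - g y) \<le> L * norm (x - y)"
    "\<And>x. norm (g x) \<le> M" "\<And>x. norm x > r \<Longrightarrow> g x = 0"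
proof -
  let ?K = "closure {x. g x \<noteq> 0}"
  let ?D = "\<lambda>x. frechet_derivative g (at x)"
  have C: "C_k k g" for k using assms by (simp add: Cc_infinity_def)
  have K: "compact ?K" using assms by (simp add: Cc_infinity_def)
  have g: "continuous_on S g" for S using C_k_continuous[OF C] continuous_on_subset by blast
  have D: "(g has_derivative ?D x) (at x)" for x by (rule C_k_frechet[OF C])
  have Dc: "continuous_on S (\<lambda>x. ?D x v)" for S v
    using C[of "Suc 0"] by (auto intro: continuous_on_subset[of UNIV])
  define N where "N x = (\<Sum>i\<in>Basis. norm (?D x i))" for x
  have "bounded (g ` ?K)" "bounded (N ` ?K)"
    unfolding N_def
    by (intro compact_imp_bounded compact_continuous_image K g continuous_intros Dc)+
  then obtain M L where M: "M > 0" "\<And>x. x \<in> ?K \<Longrightarrow> norm (g x) \<le> M"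
    and L: "L > 0" "\<And>x. x \<in> ?K \<Longrightarrow> norm (N x) \<le> L"
    unfolding bounded_pos by auto
  obtain r where r: "\<And>x. x \<in> ?K \<Longrightarrow> norm x \<le> r" using compact_imp_bounded[OF K] unfolding bounded_pos by auto
  have g0: "g x = 0" if "x \<notin> ?K" for x using that closure_subset[of "{x. g x \<noteq> 0}"] by auto
  have D0: "?D x = (\<lambda>_. 0)" if "x \<notin> ?K" for x
  proof -
    have "(g has_derivative (\<lambda>_. 0)) (at x)"
      by (rule has_derivative_transform_within_open[of "\<lambda>_. 0" _ _ _ "- ?K"])
        (use that in \<open>auto simp: open_Compl intro: g0\<close>)
    from frechet_derivative_at[OF this] show ?thesis by simp
  qed
  have on: "onorm (?D x) \<le> L" for x
  proof -
    have "onorm (?D x) \<le> N x"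
      unfolding N_def by (intro onorm_componentwise has_derivative_bounded_linear[OF D])
    also have "\<dots> \<le> L"
    proof (cases "x \<in> ?K")
      case False
      then show ?thesis using L(1) by (simp add: N_def D0)
    qed (use L(2)[of x] in auto)
    finally show ?thesis .
  qed
  show ?thesis
  proof (rule that[of L M r])
    show "norm (g x - g y) \<le> L * norm (x - y)" for x y
      by (rule differentiable_bound[of UNIV g ?D]) (auto intro: D on)
    show "norm (g x) \<le> M" for x using M g0[of x] by (cases "x \<in> ?K") auto
    show "g x = 0" if "norm x > r" for x using r[of x] that by (intro g0) auto
  qed (use L M in auto)
qed

lemma ennreal_tendsto_0I:
  assumes "\<And>e. e > 0 \<Longrightarrow> \<forall>\<^sub>F x in F. X x \<le> ennreal e"
  shows "(X \<longlongrightarrow> 0) F"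
proof (rule order_tendstoI)
  fix a :: ennreal assume "0 < a"
  then obtain c where c: "0 < c" "c < a" using dense by blast
  then obtain e where e: "c = ennreal e" "e \<ge> 0" by (cases c) auto
  then have "e > 0" using c by (simp add: ennreal_less_zero_iff)
  from assms[OF this] show "\<forall>\<^sub>F x in F. X x < a"
    by eventually_elim (use c e in auto)
qed simp

lemma ennreal_tendsto_0D:
  assumes "(X \<longlongrightarrow> (0::ennreal)) F" "e > 0"
  shows "\<forall>\<^sub>F x in F. X x \<le> ennreal e"
  using order_tendstoD(2)[OF assms(1), of "ennreal e"] assms(2)
  by (auto elim: eventually_mono)

context gauge
begin

lemma osc_lipschitz_le:
  fixes g :: "real ^ 'n \<Rightarrow> 'b::banach"
  assumes g: "\<And>x y. norm (g x - g y) \<le> L * norm (x - y)" and L: "L \<ge> 0"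
    and loc: "locally_bochner_integrable g" and l: "l > 0"
  shows "osc \<omega> g a l \<le> ennreal (2 * L * real CARD('n) * (l / \<omega> l))"
proof -
  have "norm (g x - g a) \<le> L * (real CARD('n) * l)" if "x \<in> cube a l" for x
    using g[of x a] norm_diff_cube[OF that, of a] l L
    by (meson corner_in_cube less_imp_le mult_left_mono order_trans)
  then have "osc \<omega> g a l \<le> ennreal (2 * (L * (real CARD('n) * l)) / \<omega> l)"
    using l L by (intro osc_le_of_AE_bound[where c = "g a"] loc pos AE_I2) (auto simp: space_restrict_space)
  then show ?thesis by (simp add: mult_ac)
qed

text \<open>Writing \<open>f\<close> as \<open>g - (g - f)\<close> costs at most \<open>e\<close> on
  every cube at once, so each vanishing condition has to be checked only for smooth compactly
  supported \<open>g\<close>.\<close>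

lemma BMO_closure_approx:
  fixes f :: "real ^ 'n \<Rightarrow> 'y::banach"
  assumes "f \<in> BMO_closure \<omega> Cc_infinity" "e > 0"
  shows "\<exists>g\<in>(Cc_infinity :: (real ^ 'n \<Rightarrow> 'y) set). locally_bochner_integrable g \<and>
    (\<forall>a l. l > 0 \<longrightarrow> osc \<omega> f a l \<le> osc \<omega> g a l + ennreal e)"
proof -
  from assms(1) obtain h where f: "f \<in> BMO \<omega>" and h: "\<And>k::nat. h k \<in> Cc_infinity"
    "(\<lambda>k. bmo_norm \<omega> (\<lambda>x. h k x - f x)) \<longlonglongrightarrow> 0"
    unfolding BMO_closure_def by auto
  obtain k where k: "bmo_norm \<omega> (\<lambda>x. h k x - f x) \<le> ennreal e"
    using ennreal_tendsto_0D[OF h(2) assms(2)] by (auto simp: eventually_sequentially)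
  have "continuous_on UNIV (h k)"
    using h(1)[of k] C_k_continuous by (auto simp: Cc_infinity_def)
  then have g: "locally_bochner_integrable (h k)" by (rule locally_bochner_integrable_continuous)
  have lf: "locally_bochner_integrable f" using f by (simp add: BMO_def)
  show ?thesis
  proof (intro bexI[of _ "h k"] conjI allI impI h g)
    fix a :: "real ^ 'n" and l :: real assume l: "l > 0"
    have "osc \<omega> (\<lambda>x. h k x - (h k x - f x)) a l \<le> osc \<omega> (h k) a l + osc \<omega> (\<lambda>x. h k x - f x) a l"
      by (intro osc_diff_le locally_bochner_integrable_diff g lf)
    also have "\<dots> \<le> osc \<omega> (h k) a l + ennreal e"
      using osc_le_bmo_norm[OF l] k by (intro add_left_mono) (rule order_trans)
    finally show "osc \<omega> f a l \<le> osc \<omega> (h k) a l + ennreal e" by simp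
  qed
qed

lemma add_half_ennreal: "e \<ge> 0 \<Longrightarrow> ennreal (e / 2) + ennreal (e / 2) = ennreal e"
  by (simp add: ennreal_plus[symmetric] del: ennreal_plus)

lemma BMO_closure_subset_small:
  "BMO_closure \<omega> (Cc_infinity :: (real ^ 'n \<Rightarrow> 'y::banach) set) \<subseteq> VMO_small \<omega>"
proof
  fix f :: "real ^ 'n \<Rightarrow> 'y" assume f: "f \<in> BMO_closure \<omega> Cc_infinity"
  have "((\<lambda>\<delta>. SUP a. osc \<omega> f a \<delta>) \<longlongrightarrow> 0) (at_right 0)"
  proof (rule ennreal_tendsto_0I)
    fix e :: real assume e: "e > 0"
    then have "e / 2 > 0" by simp
    then obtain g :: "real ^ 'n \<Rightarrow> 'y" where g: "g \<in> Cc_infinity" "locally_bochner_integrable g"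
      "\<And>a l. l > 0 \<Longrightarrow> osc \<omega> f a l \<le> osc \<omega> g a l + ennreal (e / 2)"
      using BMO_closure_approx[OF f, of "e / 2"] by blast
    obtain L where L: "L \<ge> 0" "\<And>x y. norm (g x - g y) \<le> L * norm (x - y)"
      using Cc_infinity_bounds[OF g(1)] by metis
    have "((\<lambda>t. 2 * L * real CARD('n) * (t / \<omega> t)) \<longlongrightarrow> 2 * L * real CARD('n) * 0) (at_right 0)"
      by (intro tendsto_intros lim_ratio)
    then have "\<forall>\<^sub>F t in at_right 0. 2 * L * real CARD('n) * (t / \<omega> t) < e / 2"
      by (rule order_tendstoD) (use e in auto)
    then show "\<forall>\<^sub>F \<delta> in at_right 0. (SUP a. osc \<omega> f a \<delta>) \<le> ennreal e"
      using eventually_at_right_less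
    proof eventually_elim
      case (elim t)
      have "osc \<omega> f a t \<le> ennreal e" for a
      proof -
        have "osc \<omega> f a t \<le> ennreal (2 * L * real CARD('n) * (t / \<omega> t)) + ennreal (e / 2)"
          using g(3)[of t a] osc_lipschitz_le[OF L(2,1) g(2), of t a] elim(2)
          by (meson add_right_mono order_trans)
        also have "\<dots> \<le> ennreal (e / 2) + ennreal (e / 2)"
          using elim(1) by (intro add_right_mono ennreal_leI) simp
        finally show ?thesis using e by (simp add: add_half_ennreal)
      qed
      then show ?case by (rule SUP_least)
    qed
  qed
  then show "f \<in> VMO_small \<omega>" using f by (simp add: VMO_small_def BMO_closure_def)
qed

lemma BMO_closure_subset_large:
  "BMO_closure \<omega> (Cc_infinity :: (real ^ 'n \<Rightarrow> 'y::banach) set) \<subseteq> VMO_large \<omega>"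
proof
  fix f :: "real ^ 'n \<Rightarrow> 'y" assume f: "f \<in> BMO_closure \<omega> Cc_infinity"
  have "((\<lambda>\<delta>. SUP a. osc \<omega> f a \<delta>) \<longlongrightarrow> 0) at_top"
  proof (rule ennreal_tendsto_0I)
    fix e :: real assume e: "e > 0"
    then have "e / 2 > 0" by simp
    then obtain g :: "real ^ 'n \<Rightarrow> 'y" where g: "g \<in> Cc_infinity" "locally_bochner_integrable g"
      "\<And>a l. l > 0 \<Longrightarrow> osc \<omega> f a l \<le> osc \<omega> g a l + ennreal (e / 2)"
      using BMO_closure_approx[OF f, of "e / 2"] by blast
    obtain M where M: "M \<ge> 0" "\<And>x. norm (g x) \<le> M"
      using Cc_infinity_bounds[OF g(1)] by metis
    obtain T where T: "T > 0" "\<And>t. T \<le> t \<Longrightarrow> 4 * M / e \<le> \<omega> t" using large_ex by blast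
    have "(SUP a. osc \<omega> f a t) \<le> ennreal e" if t: "T \<le> t" for t
    proof (rule SUP_least)
      fix a
      have t0: "t > 0" using t T(1) by simp
      have "osc \<omega> g a t \<le> ennreal (2 * M / \<omega> t)"
        using M t0 by (intro osc_le_of_AE_bound[where c = 0] g(2) pos AE_I2) auto
      also have "\<dots> \<le> ennreal (e / 2)"
        using T(2)[OF t] pos[OF t0] e by (intro ennreal_leI) (simp add: field_simps)
      finally have "osc \<omega> f a t \<le> ennreal (e / 2) + ennreal (e / 2)"
        using g(3)[OF t0, of a] by (meson add_right_mono order_trans)
      then show "osc \<omega> f a t \<le> ennreal e" using e by (simp add: add_half_ennreal)
    qed
    then show "\<forall>\<^sub>F \<delta> in at_top. (SUP a. osc \<omega> f a \<delta>) \<le> ennreal e"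
      unfolding eventually_at_top_linorder by blast
  qed
  then show "f \<in> VMO_large \<omega>" using f by (simp add: VMO_large_def BMO_closure_def)
qed

lemma BMO_closure_subset_far:
  "BMO_closure \<omega> (Cc_infinity :: (real ^ 'n \<Rightarrow> 'y::banach) set) \<subseteq> VMO_far \<omega>"
proof
  fix f :: "real ^ 'n \<Rightarrow> 'y" assume f: "f \<in> BMO_closure \<omega> Cc_infinity"
  have "((\<lambda>\<delta>. SUP (a, l)\<in>{(a, l). 0 < l \<and> setdist (cube a l) {0} > \<delta>}. osc \<omega> f a l) \<longlongrightarrow> 0) at_top"
  proof (rule ennreal_tendsto_0I)
    fix e :: real assume e: "e > 0"
    obtain g :: "real ^ 'n \<Rightarrow> 'y" where g: "g \<in> Cc_infinity" "locally_bochner_integrable g"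
      "\<And>a l. l > 0 \<Longrightarrow> osc \<omega> f a l \<le> osc \<omega> g a l + ennreal e"
      using BMO_closure_approx[OF f e] by blast
    obtain r where r: "\<And>x. norm x > r \<Longrightarrow> g x = 0"
      using Cc_infinity_bounds[OF g(1)] by metis
    have "osc \<omega> f a l \<le> ennreal e" if "r \<le> \<delta>" "0 < l" "setdist (cube a l) {0} > \<delta>" for \<delta> a l
    proof -
      have "g x = 0" if "x \<in> cube a l" for x
        using setdist_le_dist[OF that, of 0 "{0}"] \<open>r \<le> \<delta>\<close> \<open>setdist (cube a l) {0} > \<delta>\<close>
        by (intro r) simp
      then have "osc \<omega> g a l \<le> ennreal (2 * 0 / \<omega> l)"
        using that by (intro osc_le_of_AE_bound[where c = 0] g(2) pos AE_I2) (auto simp: space_restrict_space)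
      then show ?thesis using g(3)[OF that(2), of a] by simp
    qed
    then have "(SUP (a, l)\<in>{(a, l). 0 < l \<and> setdist (cube a l) {0} > \<delta>}. osc \<omega> f a l) \<le> ennreal e" if "r \<le> \<delta>" for \<delta>
      using that by (intro SUP_least) auto
    then show "\<forall>\<^sub>F \<delta> in at_top. (SUP (a, l)\<in>{(a, l). 0 < l \<and> setdist (cube a l) {0} > \<delta>}. osc \<omega> f a l) \<le> ennreal e"
      unfolding eventually_at_top_linorder by blast
  qed
  then show "f \<in> VMO_far \<omega>" using f by (simp add: VMO_far_def BMO_closure_def)
qed

section \<open>Approximation of functions with vanishing oscillation\<close>

lemma doubling_iterate: "t > 0 \<Longrightarrow> \<omega> (2 ^ m * t) \<le> C\<^sub>d ^ m * \<omega> t"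
proof (induction m)
  case (Suc m)
  have "\<omega> (2 * (2 ^ m * t)) \<le> C\<^sub>d * \<omega> (2 ^ m * t)" using Suc.prems by (intro doubling) auto
  also have "\<dots> \<le> C\<^sub>d * (C\<^sub>d ^ m * \<omega> t)" using C_ge_1 Suc by (intro mult_left_mono) auto
  finally show ?case by (simp add: mult_ac)
qed simp

text \<open>The converse of \<open>rep_modulus\<close>. Points of a cube are at most
  \<open>CARD('n) * l \<le> 2 ^ CARD('n) * l\<close> apart, so \<open>CARD('n)\<close> doublings
  return to \<open>\<omega> l\<close>. The form of \<open>eq\<close> allows for a null set and an
  additive constant.\<close>

lemma osc_le_of_modulus:
  fixes w h :: "real ^ 'n \<Rightarrow> 'y::banach"
  assumes h: "locally_bochner_integrable h" and E: "E \<ge> 0"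
    and w: "\<And>x y. x \<noteq> y \<Longrightarrow> norm (w x - w y) \<le> E * \<omega> (norm (x - y))"
    and eq: "AE x in lebesgue_on (cube a l). h x = w x + c" and l: "l > 0"
  shows "osc \<omega> h a l \<le> ennreal (2 * E * C\<^sub>d ^ CARD('n))"
proof -
  have bd: "norm (w x - w a) \<le> E * (C\<^sub>d ^ CARD('n) * \<omega> l)" if "x \<in> cube a l" for x
  proof (cases "x = a")
    case True
    then show ?thesis using E C_ge_1 nonneg[OF l] by simp
  next
    case False
    have "norm (x - a) \<le> real CARD('n) * l" using that l by (intro norm_diff_cube[of _ a]) auto
    also have "\<dots> \<le> 2 ^ CARD('n) * l"
      using l less_imp_le[OF of_nat_less_two_power[of "CARD('n)", where 'a = real]] by (intro mult_right_mono) auto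
    finally have "\<omega> (norm (x - a)) \<le> \<omega> (2 ^ CARD('n) * l)" using False by (intro mono) auto
    also have "\<dots> \<le> C\<^sub>d ^ CARD('n) * \<omega> l" by (rule doubling_iterate[OF l])
    finally show ?thesis using w[OF False] E by (meson mult_left_mono order_trans)
  qed
  have "AE x in lebesgue_on (cube a l). norm (h x - (w a + c)) \<le> E * (C\<^sub>d ^ CARD('n) * \<omega> l)"
    using eq AE_space by eventually_elim (use bd in \<open>auto simp: space_restrict_space\<close>)
  then have "osc \<omega> h a l \<le> ennreal (2 * (E * (C\<^sub>d ^ CARD('n) * \<omega> l)) / \<omega> l)"
    using E C_ge_1 nonneg[OF l] by (intro osc_le_of_AE_bound h pos l) auto
  then show ?thesis using pos[OF l] by (simp add: mult_ac)
qed

text \<open>With \<open>g\<close> the truncation of \<open>u\<close>, \<open>v - u\<close> is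
  \<open>v - g\<close> minus the part cut away. The latter contributes 5; mollifying at the radius
  \<open>d\<close> below which \<open>g\<close> has modulus \<open>e * \<omega>\<close> contributes
  2, one each for \<open>v\<close> and \<open>g\<close> at short distances and one for each point
  beyond \<open>d\<close>.\<close>

lemma mollified_truncation_ex:
  fixes u :: "'a::euclidean_space \<Rightarrow> 'y::banach"
  assumes cont: "continuous_on UNIV u" and u0: "u 0 = 0"
    and A: "A \<ge> 0" "\<And>x y. x \<noteq> y \<Longrightarrow> norm (u x - u y) \<le> A * \<omega> (norm (x - y))"
    and small: "\<And>e. e > 0 \<Longrightarrow> \<exists>d>0. \<forall>x y. x \<noteq> y \<longrightarrow> norm (x - y) \<le> d \<longrightarrow> norm (u x - u y) \<le> e * \<omega> (norm (x - y))"
    and far: "\<And>e. e > 0 \<Longrightarrow> \<exists>r>0. \<forall>x y. x \<noteq> y \<longrightarrow> norm x \<ge> r \<longrightarrow> norm (u x - u y) \<le> e * \<omega> (norm (x - y))"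
    and e: "e > 0"
  obtains v where "v \<in> Cc_infinity"
    "\<And>x y. x \<noteq> y \<Longrightarrow> norm (v x - u x - (v y - u y)) \<le> 7 * e * \<omega> (norm (x - y))"
proof -
  obtain r where r: "r > 0" "\<And>x y. x \<noteq> y \<Longrightarrow> norm x \<ge> r \<Longrightarrow> norm (u x - u y) \<le> e * \<omega> (norm (x - y))"
    using far[OF e] by blast
  obtain R where R: "R > 0" "\<And>x y. x \<noteq> y \<Longrightarrow>
      norm (ramp R x *\<^sub>R u x - ramp R y *\<^sub>R u y) \<le> 5 * e * \<omega> (norm (x - y))"
    using cutoff_modulus[OF u0 A e r] by blast
  define g where "g x = (1 - ramp R x) *\<^sub>R u x" for x
  obtain d where d: "d > 0" "\<And>x y. x \<noteq> y \<Longrightarrow> norm (x - y) \<le> d \<Longrightarrow> norm (g x - g y) \<le> e * \<omega> (norm (x - y))"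
    using truncation_modulus_small[OF cont small R(1) e] unfolding g_def by blast
  have gc: "continuous_on UNIV g"
    unfolding g_def by (intro continuous_intros cont continuous_ramp)
  have g0: "g x = 0" if "norm x \<ge> 2 * R" for x
    using ramp_1[OF R(1) that] by (simp add: g_def)
  obtain v where v: "v \<in> Cc_infinity"
    "\<And>x y c. (\<And>z. norm z \<le> d \<Longrightarrow> norm (g (x - z) - g (y - z)) \<le> c) \<Longrightarrow> norm (v x - v y) \<le> c"
    "\<And>x c. (\<And>z. norm z \<le> d \<Longrightarrow> norm (g (x - z) - g x) \<le> c) \<Longrightarrow> norm (v x - g x) \<le> c"
    using mollification_ex[OF gc g0 d(1)] by blast
  have vg: "norm (v x - g x) \<le> e * \<omega> d" for x
  proof (rule v(3))
    fix z :: 'a assume z: "norm z \<le> d"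
    show "norm (g (x - z) - g x) \<le> e * \<omega> d"
    proof (cases "z = 0")
      case False
      then have "norm (g (x - z) - g x) \<le> e * \<omega> (norm (x - z - x))" using z by (intro d(2)) auto
      also have "\<dots> \<le> e * \<omega> d" using False z e by (intro mult_left_mono mono) auto
      finally show ?thesis .
    qed (use e nonneg[OF d(1)] in simp)
  qed
  show ?thesis
  proof (rule that[OF v(1)])
    fix x y :: 'a assume xy: "x \<noteq> y"
    have "norm (v x - g x - (v y - g y)) \<le> 2 * (e * \<omega> (norm (x - y)))"
    proof (cases "norm (x - y) \<le> d")
      case True
      have "norm (v x - v y) \<le> e * \<omega> (norm (x - y))"
        using d(2)[of "x - z" "y - z" for z] xy True by (intro v(2)) simp
      then show ?thesis
        using d(2)[OF xy True] norm_triangle_ineq4[of "v x - v y" "g x - g y"] by (simp add: algebra_simps)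
    next
      case False
      then have "e * \<omega> d \<le> e * \<omega> (norm (x - y))" using d(1) e by (intro mult_left_mono mono) auto
      then show ?thesis
        using vg[of x] vg[of y] norm_triangle_ineq4[of "v x - g x" "v y - g y"] by linarith
    qed
    moreover have eq: "v x - u x - (v y - u y) = (v x - g x - (v y - g y)) - (ramp R x *\<^sub>R u x - ramp R y *\<^sub>R u y)"
      by (simp add: g_def algebra_simps)
    ultimately show "norm (v x - u x - (v y - u y)) \<le> 7 * e * \<omega> (norm (x - y))"
      using R(2)[OF xy] norm_triangle_ineq4[of "v x - g x - (v y - g y)" "ramp R x *\<^sub>R u x - ramp R y *\<^sub>R u y"]
      unfolding eq by simp
  qed
qed

lemma VMO_approx:
  fixes f :: "real ^ 'n \<Rightarrow> 'y::banach"
  assumes f: "f \<in> VMO \<omega>" and e: "e > 0"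
  obtains v where "v \<in> Cc_infinity" "bmo_norm \<omega> (\<lambda>x. v x - f x) \<le> ennreal e"
proof -
  from f have loc: "locally_bochner_integrable f" and fin: "bmo_norm \<omega> f < \<infinity>"
    and small: "((\<lambda>\<delta>. SUP a. osc \<omega> f a \<delta>) \<longlongrightarrow> 0) (at_right 0)"
    and large: "((\<lambda>\<delta>. SUP a. osc \<omega> f a \<delta>) \<longlongrightarrow> 0) at_top"
    and far: "((\<lambda>\<delta>. SUP (a, l)\<in>{(a, l). 0 < l \<and> setdist (cube a l) {0} > \<delta>}. osc \<omega> f a l) \<longlongrightarrow> 0) at_top"
    by (auto simp: VMO_def VMO_small_def VMO_large_def VMO_far_def BMO_def)
  obtain B where B: "bmo_norm \<omega> f = ennreal B" "B \<ge> 0" using fin by (cases "bmo_norm \<omega> f") auto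
  interpret bmo_function \<omega> C\<^sub>d D f B
    by unfold_locales (use loc B osc_le_bmo_norm[of _ \<omega> f] in simp_all)
  have S: "\<exists>d>0. \<forall>a r. 0 < r \<longrightarrow> r \<le> d \<longrightarrow> osc \<omega> f a r \<le> ennreal e'" if e': "e' > 0" for e'
  proof -
    obtain b where b: "b > 0" "\<And>r. 0 < r \<Longrightarrow> r < b \<Longrightarrow> (SUP a. osc \<omega> f a r) \<le> ennreal e'"
      using ennreal_tendsto_0D[OF small e'] unfolding eventually_at_right_field by auto
    have "osc \<omega> f a r \<le> ennreal e'" if "0 < r" "r \<le> b / 2" for a r
      using b(1) b(2)[of r] that SUP_upper[of a UNIV "\<lambda>a. osc \<omega> f a r"] by auto
    then show ?thesis using b(1) by (intro exI[of _ "b / 2"]) auto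
  qed
  have L: "\<exists>M>0. \<forall>a r. r \<ge> M \<longrightarrow> osc \<omega> f a r \<le> ennreal e'" if e': "e' > 0" for e'
  proof -
    obtain M where M: "\<And>r. M \<le> r \<Longrightarrow> (SUP a. osc \<omega> f a r) \<le> ennreal e'"
      using ennreal_tendsto_0D[OF large e'] unfolding eventually_at_top_linorder by auto
    have "osc \<omega> f a r \<le> ennreal e'" if "max M 1 \<le> r" for a r
      using M[of r] that SUP_upper[of a UNIV "\<lambda>a. osc \<omega> f a r"] by auto
    then show ?thesis by (intro exI[of _ "max M 1"]) auto
  qed
  have F: "\<exists>\<delta>>0. \<forall>a r. r > 0 \<longrightarrow> (\<forall>z\<in>cube a r. norm z > \<delta>) \<longrightarrow> osc \<omega> f a r \<le> ennreal e'" if e': "e' > 0" for e'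
  proof -
    obtain N where N: "(SUP (a, l)\<in>{(a, l). 0 < l \<and> setdist (cube a l) {0} > N}. osc \<omega> f a l) \<le> ennreal e'"
      using ennreal_tendsto_0D[OF far e'] unfolding eventually_at_top_linorder by auto
    \<comment> \<open>A pointwise strict bound gives only a weak one for the infimum
      \<open>setdist\<close>; the summand 1 restores strictness above \<open>N\<close>.\<close>
    have "osc \<omega> f a r \<le> ennreal e'" if "r > 0" "\<forall>z\<in>cube a r. norm z > max N 0 + 1" for a r
    proof -
      have "max N 0 + 1 \<le> setdist (cube a r) {0}"
        using that by (intro le_setdistI) (auto simp: cube_def[symmetric] intro: less_imp_le corner_in_cube)
      then have "(a, r) \<in> {(a, l). 0 < l \<and> setdist (cube a l) {0} > N}" using that(1) by auto
      from SUP_upper[OF this, of "\<lambda>(a, l). osc \<omega> f a l"] N show ?thesis by (auto intro: order_trans)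
    qed
    then show ?thesis by (intro exI[of _ "max N 0 + 1"]) auto
  qed
  \<comment> \<open>14 is the 7 of \<open>mollified_truncation_ex\<close> times the 2 of
    \<open>osc_le_of_modulus\<close>, which also contributes the power of
    \<open>C\<^sub>d\<close>.\<close>
  define E where "E = e / (14 * C\<^sub>d ^ CARD('n))"
  have E: "E > 0" using e C_ge_1 by (simp add: E_def)
  define u where "u x = rep x - rep 0" for x
  have KB: "K * B \<ge> 0" using K_pos B(2) by simp
  obtain v where v: "v \<in> Cc_infinity"
    "\<And>x y. x \<noteq> y \<Longrightarrow> norm (v x - u x - (v y - u y)) \<le> 7 * E * \<omega> (norm (x - y))"
  proof (rule mollified_truncation_ex[of u, OF _ _ KB _ _ _ E])
    show "continuous_on UNIV u" unfolding u_def by (intro continuous_intros continuous_rep)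
  qed (use rep_modulus_global rep_modulus_small[OF S] rep_modulus_far[OF L F] in \<open>auto simp: u_def\<close>)
  have "continuous_on UNIV v" using v(1) C_k_continuous by (auto simp: Cc_infinity_def)
  then have vl: "locally_bochner_integrable (\<lambda>x. v x - f x)"
    by (intro locally_bochner_integrable_diff loc locally_bochner_integrable_continuous)
  have "bmo_norm \<omega> (\<lambda>x. v x - f x) \<le> ennreal (2 * (7 * E) * C\<^sub>d ^ CARD('n))"
  proof (rule bmo_norm_leI)
    fix a :: "real ^ 'n" and l :: real assume l: "l > 0"
    show "osc \<omega> (\<lambda>x. v x - f x) a l \<le> ennreal (2 * (7 * E) * C\<^sub>d ^ CARD('n))"
    proof (rule osc_le_of_modulus[OF vl _ v(2) _ l])
      show "AE x in lebesgue_on (cube a l). v x - f x = v x - u x + (- rep 0)"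
        using AE_rep[OF l] by eventually_elim (simp add: u_def)
    qed (use E in auto)
  qed
  also have "2 * (7 * E) * C\<^sub>d ^ CARD('n) = e" using C_ge_1 by (simp add: E_def)
  finally show ?thesis using v(1) that by blast
qed

lemma VMO_eq_BMO_closure: "(VMO \<omega> :: (real ^ 'n \<Rightarrow> 'y::banach) set) = BMO_closure \<omega> Cc_infinity"
proof
  show "BMO_closure \<omega> Cc_infinity \<subseteq> (VMO \<omega> :: (real ^ 'n \<Rightarrow> 'y) set)"
    unfolding VMO_def
    using BMO_closure_subset_small BMO_closure_subset_large BMO_closure_subset_far by blast
next
  show "(VMO \<omega> :: (real ^ 'n \<Rightarrow> 'y) set) \<subseteq> BMO_closure \<omega> Cc_infinity"
  proof
    fix f :: "real ^ 'n \<Rightarrow> 'y" assume f: "f \<in> VMO \<omega>"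
    have "\<exists>v\<in>Cc_infinity. bmo_norm \<omega> (\<lambda>x. v x - f x) \<le> ennreal (inverse (real (Suc k)))" for k
      using VMO_approx[OF f, of "inverse (real (Suc k))"] by auto
    then obtain v where v: "\<And>k. v k \<in> Cc_infinity"
      "\<And>k. bmo_norm \<omega> (\<lambda>x. v k x - f x) \<le> ennreal (inverse (real (Suc k)))" by metis
    have "(\<lambda>k. bmo_norm \<omega> (\<lambda>x. v k x - f x)) \<longlonglongrightarrow> 0"
      by (rule tendsto_sandwich[OF _ _ tendsto_const tendsto_ennrealI[OF LIMSEQ_inverse_real_of_nat, simplified]])
        (use v(2) in auto)
    then show "f \<in> BMO_closure \<omega> Cc_infinity"
      using f v(1) unfolding BMO_closure_def VMO_def VMO_small_def by blast
  qed
qed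

end

text \<open>On the interval from \<open>s / 2 ^ Suc j\<close> to \<open>s / 2 ^ j\<close> the
  integrand is at least \<open>\<omega> (s / 2 ^ Suc j) / (s / 2 ^ j)\<close>, and the length is
  half of that denominator: each interval contributes at least half a term of the sum, hence the
  factor 2.\<close>

lemma dyadic_sum_le_of_dini:
  assumes pos: "\<And>t. t > 0 \<Longrightarrow> \<omega> t > 0"
    and mono: "\<And>s t. 0 < s \<Longrightarrow> s \<le> t \<Longrightarrow> \<omega> s \<le> \<omega> t"
    and dini: "(\<integral>\<^sup>+t\<in>{0<..<s}. ennreal (\<omega> t / t) \<partial>lborel) \<le> ennreal I" "I \<ge> 0"
    and s: "s > (0::real)"
  shows "(\<Sum>j<k. \<omega> (s / 2 ^ Suc j)) \<le> 2 * I"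
proof -
  define J where "J j = {s / 2 ^ Suc j<..<s / 2 ^ j}" for j :: nat
  define c where "c j = \<omega> (s / 2 ^ Suc j) / (s / 2 ^ j)" for j :: nat
  have c: "c j \<ge> 0" for j unfolding c_def using s pos[of "s / 2 ^ Suc j"] by simp
  \<comment> \<open>The restricted right-hand side makes the induction work: for \<open>t\<close> in
    \<open>J k\<close> it is 0 at stage \<open>k\<close>, so all earlier terms vanish there.\<close>
  have pw: "(\<Sum>j<k. ennreal (c j) * indicator (J j) t) \<le> ennreal (\<omega> t / t) * indicator {s / 2 ^ k<..<s} t" for k t
  proof (induction k)
    case (Suc k)
    show ?case
    proof (cases "t \<in> J k")
      case True
      then have t: "s / 2 ^ Suc k < t" "t < s / 2 ^ k" by (auto simp: J_def)
      have t0: "t > 0" using s by (intro less_trans[OF _ t(1)]) simp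
      have "s / 2 ^ k \<le> s / 1" using s by (intro divide_left_mono) auto
      then have ts: "t < s" using t(2) by simp
      have "c k \<le> \<omega> t / t"
        unfolding c_def using t t0 s pos[OF t0] by (intro frac_le mono) auto
      moreover have "(\<Sum>j<k. ennreal (c j) * indicator (J j) t) = 0"
        using Suc.IH t by simp
      ultimately show ?thesis using True t ts by (simp add: ennreal_leI)
    next
      case False
      have "s / 2 ^ Suc k \<le> s / 2 ^ k" using s by (simp add: field_simps)
      then have "indicator {s / 2 ^ k<..<s} t \<le> (indicator {s / 2 ^ Suc k<..<s} t :: ennreal)"
        by (auto split: split_indicator)
      then have "ennreal (\<omega> t / t) * indicator {s / 2 ^ k<..<s} t \<le> ennreal (\<omega> t / t) * indicator {s / 2 ^ Suc k<..<s} t"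
        by (rule mult_left_mono) simp
      with Suc.IH have "(\<Sum>j<k. ennreal (c j) * indicator (J j) t) \<le> ennreal (\<omega> t / t) * indicator {s / 2 ^ Suc k<..<s} t"
        by (rule order_trans)
      then show ?thesis using False by (simp del: power_Suc)
    qed
  qed simp
  have cj: "c j * (s / 2 ^ j - s / 2 ^ Suc j) = \<omega> (s / 2 ^ Suc j) / 2" for j
  proof -
    define q where "q = s / 2 ^ j"
    have q: "s / 2 ^ Suc j = q / 2" "q > 0" using s by (simp_all add: q_def)
    show ?thesis unfolding c_def q(1) q_def[symmetric] using q(2) by simp
  qed
  have J: "emeasure lborel (J j) = ennreal (s / 2 ^ j - s / 2 ^ Suc j)" for j
    unfolding J_def using s by (subst emeasure_lborel_Ioo) (auto simp: field_simps)
  have "ennreal (\<Sum>j<k. \<omega> (s / 2 ^ Suc j) / 2) = (\<Sum>j<k. ennreal (c j) * emeasure lborel (J j))"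
    unfolding J ennreal_mult'[OF c, symmetric] cj
    by (intro sum_ennreal[symmetric] divide_nonneg_pos less_imp_le[OF pos]) (use s in simp_all)
  also have "\<dots> = (\<integral>\<^sup>+t. (\<Sum>j<k. ennreal (c j) * indicator (J j) t) \<partial>lborel)"
    by (subst nn_integral_sum) (auto simp: J_def nn_integral_cmult_indicator)
  also have "\<dots> \<le> (\<integral>\<^sup>+t\<in>{0<..<s}. ennreal (\<omega> t / t) \<partial>lborel)"
  proof (rule nn_integral_mono)
    fix t
    have "s / 2 ^ k > 0" using s by simp
    then have "indicator {s / 2 ^ k<..<s} t \<le> (indicator {0<..<s} t :: ennreal)"
      by (auto split: split_indicator)
    then show "(\<Sum>j<k. ennreal (c j) * indicator (J j) t) \<le> ennreal (\<omega> t / t) * indicator {0<..<s} t"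
      using pw[where k = k and t = t] by (meson mult_left_mono order_trans zero_le)
  qed
  also have "\<dots> \<le> ennreal I" by (rule dini)
  finally have "(\<Sum>j<k. \<omega> (s / 2 ^ Suc j) / 2) \<le> I" using dini(2) by simp
  then show ?thesis by (simp add: sum_divide_distrib[symmetric])
qed

theorem theorem1p10:
  fixes \<omega> :: "real \<Rightarrow> real"
  assumes pos: "\<And>t. t > 0 \<Longrightarrow> \<omega> t > 0"
    and mono: "mono_on {0<..} \<omega>"
    and lim_0: "(\<omega> \<longlongrightarrow> 0) (at_right 0)"
    and lim_infinity: "filterlim \<omega> at_top at_top"
    and lim_ratio: "((\<lambda>t. t / \<omega> t) \<longlongrightarrow> 0) (at_right 0)"
    and doubling: "\<exists>C_db>1. \<forall>t>0. \<omega> (2 * t) \<le> C_db * \<omega> t"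
    and dini: "(SUP s\<in>{0<..}. 1 / ennreal (\<omega> s) *
                 (\<integral>\<^sup>+t\<in>{0<..<s}. ennreal (\<omega> t / t) \<partial>lborel)) < \<infinity>"
  shows "(VMO \<omega> :: (real ^ 'n \<Rightarrow> 'y::banach) set) = BMO_closure \<omega> Cc_infinity"
proof -
  have mono': "\<omega> s \<le> \<omega> t" if "0 < s" "s \<le> t" for s t
    using mono that by (auto intro: mono_onD)
  obtain C\<^sub>d where C: "\<And>t. t > 0 \<Longrightarrow> \<omega> (2 * t) \<le> C\<^sub>d * \<omega> t" using doubling by blast
  obtain C where C0: "C \<ge> 0" and CS: "(SUP s\<in>{0<..}. 1 / ennreal (\<omega> s) *
      (\<integral>\<^sup>+t\<in>{0<..<s}. ennreal (\<omega> t / t) \<partial>lborel)) = ennreal C"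
    using dini by (cases "SUP s\<in>{0<..}. 1 / ennreal (\<omega> s) *
      (\<integral>\<^sup>+t\<in>{0<..<s}. ennreal (\<omega> t / t) \<partial>lborel)") auto
  have I: "(\<integral>\<^sup>+t\<in>{0<..<s}. ennreal (\<omega> t / t) \<partial>lborel) \<le> ennreal (C * \<omega> s)" if s: "s > 0" for s
  proof -
    let ?I = "\<integral>\<^sup>+t\<in>{0<..<s}. ennreal (\<omega> t / t) \<partial>lborel"
    have w: "ennreal (\<omega> s) * (1 / ennreal (\<omega> s)) = 1"
      using pos[OF s] by (simp add: divide_ennreal ennreal_mult'[symmetric] flip: ennreal_1)
    have "1 / ennreal (\<omega> s) * ?I \<le> ennreal C"
      unfolding CS[symmetric] using s by (intro SUP_upper) auto
    then have "ennreal (\<omega> s) * (1 / ennreal (\<omega> s) * ?I) \<le> ennreal (\<omega> s) * ennreal C"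
      by (rule mult_left_mono) simp
    then show ?thesis
      using pos[OF s] C0 by (simp add: mult.assoc[symmetric] w ennreal_mult'' mult.commute)
  qed
  \<comment> \<open>The 1 accounts for the top term \<open>\<omega> s\<close>, which the dyadic
    bound by the integral does not cover.\<close>
  interpret gauge \<omega> C\<^sub>d "1 + 2 * C"
  proof
    fix s :: real and k assume s: "s > 0"
    have "(\<Sum>j\<le>k. \<omega> (s / 2 ^ j)) = \<omega> s + (\<Sum>j<k. \<omega> (s / 2 ^ Suc j))"
      by (simp add: lessThan_Suc_atMost[symmetric] sum.lessThan_Suc_shift del: power_Suc sum.lessThan_Suc)
    also have "\<dots> \<le> \<omega> s + 2 * (C * \<omega> s)"
      using C0 pos[OF s] by (intro add_left_mono dyadic_sum_le_of_dini pos mono' I s) auto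
    finally show "(\<Sum>j\<le>k. \<omega> (s / 2 ^ j)) \<le> (1 + 2 * C) * \<omega> s" by (simp add: algebra_simps)
  qed (use pos mono' lim_0 lim_infinity lim_ratio C in auto)
  show ?thesis by (rule VMO_eq_BMO_closure)
qed

end
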